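(* For any positive integer $N$, there exists a non-splittable $\mathbb{Z}$-colorable link $L$ and a minimal diagram $D$ of $L$ such that every non-trivial $\mathbb{Z}$-coloring on $D$ has at least $N$ colors.
   Context: Links are links in the 3-space, and diagrams are regular diagrams; an arc of a diagram runs from undercrossing to undercrossing. Let $D$ be a diagram of a link. A map $\gamma$ from the set of arcs of $D$ to $\mathbb{Z}$ is called a $\mathbb{Z}$-coloring on $D$ if $2\gamma(a)=\gamma(b)+\gamma(c)$ holds at each crossing of $D$ with over arc $a$ and under arcs $b$ and $c$. The integers in the image of $\gamma$ are called the colors of $\gamma$; the number of colors of $\gamma$ is the cardinality of its image. A $\mathbb{Z}$-coloring is trivial if it assigns the same integer to all arcs, and non-trivial otherwise. A link is $\mathbb{Z}$-colorable if it has a diagram admitting a non-trivial $\mathbb{Z}$-coloring. A minimal diagram of a link is a diagram representing the link with the least number of crossings among all diagrams of the link. *)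

theory Defs
  imports "HOL-Analysis.Analysis"
begin

section \<open>Links in three-space\<close>

text \<open>A polygonal path is a finite concatenation of straight segments.\<close>

inductive polygonal_path :: "(real \<Rightarrow> 'a::real_normed_vector) \<Rightarrow> bool" where
  segment: "polygonal_path (linepath a b)"
| join: "polygonal_path g \<Longrightarrow> polygonal_path (linepath a (pathstart g) +++ g)"

definition simple_closed_polygon :: "(real^3) set \<Rightarrow> bool" where
  "simple_closed_polygon C \<longleftrightarrow>
     (\<exists>g. polygonal_path g \<and> simple_path g \<and> pathfinish g = pathstart g \<and> path_image g = C)"

definition polygonal_link :: "(real^3) set \<Rightarrow> bool" where
  "polygonal_link P \<longleftrightarrow>
     P \<noteq> {} \<and> finite (components P) \<and> (\<forall>C\<in>components P. simple_closed_polygon C)"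

definition ambient_isotopic :: "(real^3) set \<Rightarrow> (real^3) set \<Rightarrow> bool" where
  "ambient_isotopic A B \<longleftrightarrow>
     (\<exists>h :: real \<times> (real^3) \<Rightarrow> real^3.
        continuous_on ({0..1} \<times> UNIV) h \<and>
        (\<forall>t\<in>{0..1}. \<exists>k. homeomorphism UNIV UNIV (\<lambda>x. h (t, x)) k) \<and>
        (\<forall>x. h (0, x) = x) \<and>
        (\<lambda>x. h (1, x)) ` A = B)"

text \<open>Links are unoriented and tame, that is, ambient isotopic to polygonal links. A link is
  given by its underlying point set; its components are the connected components of that set.\<close>

definition link :: "(real^3) set \<Rightarrow> bool" where
  "link L \<longleftrightarrow> (\<exists>P. polygonal_link P \<and> ambient_isotopic P L)"

text \<open>A splitting sphere is a tame 2-sphere in the complement of the link with a part of the link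
  on either side.\<close>

definition splittable :: "(real^3) set \<Rightarrow> bool" where
  "splittable L \<longleftrightarrow>
     (\<exists>S. ambient_isotopic (sphere 0 1) S \<and> S \<inter> L = {} \<and>
          inside S \<inter> L \<noteq> {} \<and> outside S \<inter> L \<noteq> {})"


section \<open>Regular diagrams\<close>

text \<open>Diagrams are drawn in the plane of the first two coordinates, and the third coordinate is the
  height. A diagram (a regular projection together with the over/under information) is encoded by
  a polygonal link in regular position, from which both can be read off.\<close>

definition plane_proj :: "real^3 \<Rightarrow> real \<times> real" where
  "plane_proj x = (x $ 1, x $ 2)"

definition crossings :: "(real^3) set \<Rightarrow> (real \<times> real) set" where
  "crossings D = {p. \<exists>x\<in>D. \<exists>y\<in>D. x \<noteq> y \<and> plane_proj x = p \<and> plane_proj y = p}"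

definition locally_straight_at :: "(real^3) set \<Rightarrow> real^3 \<Rightarrow> bool" where
  "locally_straight_at D x \<longleftrightarrow>
     (\<exists>e>0. \<exists>v. v \<noteq> 0 \<and> D \<inter> ball x e = range (\<lambda>t. x + t *\<^sub>R v) \<inter> ball x e)"

text \<open>The projection has finitely many multiple points, all of them are double points, and no
  vertex projects to a double point. These conditions force the two strands at a double point to
  cross transversally: vertical or overlapping strands would give a point with infinitely many
  preimages or infinitely many double points.\<close>

definition regular_diagram :: "(real^3) set \<Rightarrow> bool" where
  "regular_diagram D \<longleftrightarrow>
     polygonal_link D \<and> finite (crossings D) \<and>
     (\<forall>p\<in>crossings D. card {x\<in>D. plane_proj x = p} = 2) \<and>
     (\<forall>x\<in>D. plane_proj x \<in> crossings D \<longrightarrow> locally_straight_at D x)"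

definition diagram_of :: "(real^3) set \<Rightarrow> (real^3) set \<Rightarrow> bool" where
  "diagram_of D L \<longleftrightarrow> regular_diagram D \<and> ambient_isotopic D L"

definition minimal_diagram_of :: "(real^3) set \<Rightarrow> (real^3) set \<Rightarrow> bool" where
  "minimal_diagram_of D L \<longleftrightarrow>
     diagram_of D L \<and> (\<forall>D'. diagram_of D' L \<longrightarrow> card (crossings D) \<le> card (crossings D'))"

definition lies_below :: "real^3 \<Rightarrow> real^3 \<Rightarrow> bool" where
  "lies_below x y \<longleftrightarrow> plane_proj x = plane_proj y \<and> x $ 3 < y $ 3"

definition under_points :: "(real^3) set \<Rightarrow> (real^3) set" where
  "under_points D = {x\<in>D. \<exists>y\<in>D. lies_below x y}"

text \<open>Cutting the link at its under points leaves the arcs running from undercrossing to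
  undercrossing; a component that never passes under is a single closed arc.\<close>

definition diagram_arcs :: "(real^3) set \<Rightarrow> (real^3) set set" where
  "diagram_arcs D = components (D - under_points D)"


section \<open>Colorings by integers\<close>

text \<open>The under arcs at a crossing are the arcs having the under point \<open>x\<close> as an end point. The set
  of these arcs is a singleton if both ends belong to the same arc, and then \<open>b = c\<close> below.
  Only the values of \<open>\<gamma>\<close> on the arcs of \<open>D\<close> matter.\<close>

definition Z_coloring :: "(real^3) set \<Rightarrow> ((real^3) set \<Rightarrow> int) \<Rightarrow> bool" where
  "Z_coloring D \<gamma> \<longleftrightarrow>
     (\<forall>x\<in>D. \<forall>y\<in>D. lies_below x y \<longrightarrow>
        (\<forall>a\<in>diagram_arcs D. \<forall>b c.
           y \<in> a \<and> {b, c} = {u\<in>diagram_arcs D. x \<in> closure u} \<longrightarrow> 2 * \<gamma> a = \<gamma> b + \<gamma> c))"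

definition colors :: "(real^3) set \<Rightarrow> ((real^3) set \<Rightarrow> int) \<Rightarrow> int set" where
  "colors D \<gamma> = \<gamma> ` diagram_arcs D"

definition trivial_coloring :: "(real^3) set \<Rightarrow> ((real^3) set \<Rightarrow> int) \<Rightarrow> bool" where
  "trivial_coloring D \<gamma> \<longleftrightarrow> (\<exists>k. \<forall>a\<in>diagram_arcs D. \<gamma> a = k)"

definition Z_colorable :: "(real^3) set \<Rightarrow> bool" where
  "Z_colorable L \<longleftrightarrow> (\<exists>D \<gamma>. diagram_of D L \<and> Z_coloring D \<gamma> \<and> \<not> trivial_coloring D \<gamma>)"

end

theory Submission
  imports Defs
begin

text \<open>
The link is a closed chain of \<open>2k\<close> rings, \<open>k = max N 2\<close>, in which each ring clasps the next one: it is
the pretzel link with \<open>2k\<close> columns of two crossings each, \<open>k\<close> of them of one sign and \<open>k\<close> of the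
other. Each ring is drawn as the boundary of a square \<open>[a, b] \<times> [a, b]\<close> on the diagonal of the plane,
and it lies in the plane of height \<open>s (y - x)\<close>, which contains that diagonal. Two such squares meet only
if the intervals \<open>[a, b]\<close> interleave, and then in two points that are mirror images in the diagonal.
Since the height changes sign under this mirror image, the ring of larger slope \<open>s\<close> is above at one
of the two points and below at the other.

Minimality and non-splittability come from linking. Call a component \<open>A\<close> unlinked from \<open>B\<close> if the inclusion
of \<open>A\<close> into the complement of \<open>B\<close> is null-homotopic; this is invariant under homeomorphisms of space.
If \<open>A\<close> is nowhere above \<open>B\<close> in a diagram, it can be pushed down and away from \<open>B\<close>, hence is unlinked from
\<open>B\<close> (\<open>shrinks_in_complement_if_nowhere_above\<close>). So in every diagram of a link, each ordered pair of
linked components has a crossing of its own, where the first is above the second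
(\<open>card_linked_pairs_le_crossings\<close>). Two interleaved rings are linked in both orders: the
complement of one of them maps to the punctured plane in such a way that the other winds once around the
puncture (\<open>interleaved_rings_linked\<close>). In the diagram of the chain, any two linked rings
have just two crossings, one for each order, and so the diagram is minimal. A splitting sphere makes any component inside it
unlinked from any component outside it, and so would disconnect the chain.

For the colorings, each ring has two under points and therefore two arcs, both of which end at
both under points. So the over arc at any crossing above ring \<open>j\<close> has half the sum \<open>M j\<close> of the two
colors of \<open>j\<close>. If the slope of a ring lies between the slopes of its two neighbors \<open>p\<close> and \<open>q\<close>, its two over
points lie on different arcs, which gives \<open>M p + M q = 2 * M i\<close>; if the slope is extremal among the
three, both over points lie on the same arc, which gives \<open>M p = M q\<close>. With rings
indexed by \<open>- k < p \<le> k\<close> and slopes \<open>\<bar>p\<bar>\<close>, the function \<open>M\<close> must be an affine function of \<open>\<bar>p\<bar>\<close>. It is constant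
exactly for trivial colorings, and otherwise takes \<open>k + 1\<close> values, all of which are doubled colors.
Conversely \<open>M p = 2 * \<bar>p\<bar>\<close> does come from a coloring.
\<close>

section \<open>Linking as an obstruction to moving one component off another\<close>

definition shrinks_in :: "'a::topological_space set \<Rightarrow> 'a set \<Rightarrow> bool" where
  "shrinks_in A U \<longleftrightarrow> (\<exists>c. homotopic_with_canon (\<lambda>_. True) A U id (\<lambda>_. c))"

lemma shrinks_in_through_contractible:
  assumes "A \<subseteq> C" "contractible C" "C \<subseteq> U"
  shows "shrinks_in A U"
proof -
  obtain c where "homotopic_with_canon (\<lambda>_. True) A C id (\<lambda>_. c)"
    by (rule nullhomotopic_into_contractible[of A id C]) (use assms in auto)
  then show ?thesis
    unfolding shrinks_in_def using homotopic_with_subset_right assms(3) by blast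
qed

lemma shrinks_in_homeomorphism_image:
  assumes H: "homeomorphism UNIV UNIV H K" and "shrinks_in A (- B)"
  shows "shrinks_in (H ` A) (- (H ` B))"
proof -
  have KH: "K (H x) = x" "H (K y) = y" for x y
    using H by (auto simp: homeomorphism_def)
  obtain c where "homotopic_with_canon (\<lambda>_. True) A (- B) id (\<lambda>_. c)"
    using assms(2) by (auto simp: shrinks_in_def)
  then have "homotopic_with_canon (\<lambda>_. True) A (- (H ` B)) (H \<circ> id) (H \<circ> (\<lambda>_. c))"
  proof (rule homotopic_with_compose_continuous_left)
    show "continuous_on (- B) H"
      using H continuous_on_subset by (auto simp: homeomorphism_def)
    show "H \<in> (- B) \<rightarrow> - (H ` B)"
      by (auto, metis KH(1))
  qed
  then have "homotopic_with_canon (\<lambda>_. True) (H ` A) (- (H ` B)) (H \<circ> id \<circ> K) (H \<circ> (\<lambda>_. c) \<circ> K)"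
  proof (rule homotopic_with_compose_continuous_right)
    show "continuous_on (H ` A) K"
      using H continuous_on_subset by (auto simp: homeomorphism_def)
    show "K \<in> H ` A \<rightarrow> A"
      by (auto simp: KH)
  qed
  moreover have "H \<circ> id \<circ> K = id" "H \<circ> (\<lambda>_. c) \<circ> K = (\<lambda>_. H c)"
    by (auto simp: KH)
  ultimately show ?thesis
    by (auto simp: shrinks_in_def)
qed

text \<open>Push \<open>A\<close> straight down. On its way no point of \<open>A\<close> meets a point of \<open>B\<close>, as that point would lie below it;
far down, \<open>A\<close> sits in a half-space that is disjoint from \<open>B\<close> and contracts there.\<close>

lemma shrinks_in_complement_if_nowhere_above:
  fixes A B :: "(real^3) set"
  assumes "bounded A" "bounded B" "A \<inter> B = {}"
    and below: "\<And>x y. x \<in> A \<Longrightarrow> y \<in> B \<Longrightarrow> \<not> lies_below y x"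
  shows "shrinks_in A (- B)"
proof -
  obtain M where M: "\<And>x. x \<in> A \<union> B \<Longrightarrow> norm x \<le> M"
    using assms(1,2) bounded_Un bounded_iff by metis
  have M3: "\<bar>x $ 3\<bar> \<le> M" if "x \<in> A \<union> B" for x
    using M[OF that] component_le_norm_cart[of x 3] by linarith
  let ?push = "\<lambda>x::real^3. x - (2 * \<bar>M\<bar> + 1) *\<^sub>R axis 3 1"
  let ?C = "{x::real^3. axis 3 1 \<bullet> x < - M}"
  have "homotopic_with_canon (\<lambda>_. True) A (- B) id ?push"
  proof (rule homotopic_with_linear)
    show "continuous_on A id" "continuous_on A ?push"
      by (auto intro!: continuous_intros)
    fix x assume x: "x \<in> A"
    show "closed_segment (id x) (?push x) \<subseteq> - B"
    proof
      fix y assume "y \<in> closed_segment (id x) (?push x)"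
      then obtain u where u: "0 \<le> u" "u \<le> 1" "y = (1 - u) *\<^sub>R x + u *\<^sub>R ?push x"
        by (auto simp: closed_segment_def)
      then have y: "y = x - (u * (2 * \<bar>M\<bar> + 1)) *\<^sub>R axis 3 1"
        by (simp add: algebra_simps)
      show "y \<in> - B"
      proof
        assume "y \<in> B"
        then have "y \<noteq> x" using x assms(3) by auto
        then have "u * (2 * \<bar>M\<bar> + 1) > 0"
          using y u(1) by (cases "u = 0") auto
        then have "lies_below y x"
          unfolding lies_below_def plane_proj_def y by (simp add: axis_def)
        then show False using below x \<open>y \<in> B\<close> by blast
      qed
    qed
  qed
  moreover obtain c where "homotopic_with_canon (\<lambda>_. True) A ?C ?push (\<lambda>_. c)"
  proof (rule nullhomotopic_into_contractible)
    show "continuous_on A ?push"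
      by (auto intro!: continuous_intros)
    show "?push \<in> A \<rightarrow> ?C"
    proof
      fix x assume "x \<in> A"
      then show "?push x \<in> ?C"
        using M3[of x] by (simp add: inner_axis' axis_nth)
    qed
    show "contractible ?C" by (intro convex_imp_contractible convex_halfspace_lt)
  qed
  moreover have "?C \<subseteq> - B"
  proof
    fix x assume "x \<in> ?C"
    then show "x \<in> - B"
      using M3[of x] by (auto simp: inner_axis')
  qed
  ultimately show ?thesis
    unfolding shrinks_in_def by (meson homotopic_with_subset_right homotopic_with_trans)
qed

text \<open>The pairs are ordered because the two orders account for two different crossings, and because
null-homotopy in the complement is not visibly a symmetric notion.\<close>

definition linked_pairs :: "(real^3) set \<Rightarrow> ((real^3) set \<times> (real^3) set) set" where
  "linked_pairs D = {(A, B). A \<in> components D \<and> B \<in> components D \<and> A \<noteq> B \<and> \<not> shrinks_in A (- B)}"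

lemma components_homeomorphism_image:
  fixes D :: "'a::real_normed_vector set"
  assumes H: "homeomorphism UNIV UNIV H K" and A: "A \<in> components D"
  shows "H ` A \<in> components (H ` D)"
proof -
  have KH: "K (H x) = x" "H (K y) = y" for x y
    using H by (auto simp: homeomorphism_def)
  have cont: "continuous_on X H" "continuous_on Y K" for X Y
    using H continuous_on_subset by (auto simp: homeomorphism_def)
  show ?thesis
    unfolding in_components_maximal
  proof (intro conjI allI impI)
    show "H ` A \<noteq> {}" "H ` A \<subseteq> H ` D" "connected (H ` A)"
      using A by (auto simp: in_components_maximal intro: connected_continuous_image cont)
    fix C assume C: "C \<noteq> {} \<and> H ` A \<subseteq> C \<and> C \<subseteq> H ` D \<and> connected C"
    have "A \<subseteq> K ` C" "K ` C \<subseteq> D" "K ` C \<noteq> {}"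
      using C by (auto simp: image_subset_iff, metis KH(1) image_eqI, metis KH(1) image_iff subsetD)
    moreover have "connected (K ` C)"
      using C by (intro connected_continuous_image cont) auto
    ultimately have "K ` C = A" using A by (simp add: in_components_maximal)
    then show "C = H ` A" by (metis (no_types, lifting) KH(2) image_cong image_ident image_image)
  qed
qed

lemma card_linked_pairs_homeomorphism_image:
  assumes H: "homeomorphism UNIV UNIV H K" and fin: "finite (components (H ` D))"
  shows "card (linked_pairs D) \<le> card (linked_pairs (H ` D))"
proof (rule card_inj_on_le)
  have KH: "K (H x) = x" "H (K y) = y" for x y
    using H by (auto simp: homeomorphism_def)
  then have inj: "inj H" by (metis injI)
  show "inj_on (map_prod ((`) H) ((`) H)) (linked_pairs D)"
    using inj by (auto simp: inj_on_def inj_image_eq_iff)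
  show "finite (linked_pairs (H ` D))"
    by (rule finite_subset[of _ "components (H ` D) \<times> components (H ` D)"])
      (auto simp: linked_pairs_def fin)
  have pull: "shrinks_in A (- B)" if "shrinks_in (H ` A) (- H ` B)" for A B
    using shrinks_in_homeomorphism_image[OF homeomorphism_symD[OF H], of "H ` A" "H ` B"] that
    by (simp add: image_image KH)
  show "map_prod ((`) H) ((`) H) ` linked_pairs D \<subseteq> linked_pairs (H ` D)"
  proof (rule image_subsetI)
    fix P assume "P \<in> linked_pairs D"
    then obtain A B where "P = (A, B)" "(A, B) \<in> linked_pairs D" by (cases P) auto
    then show "map_prod ((`) H) ((`) H) P \<in> linked_pairs (H ` D)"
      using pull[of A B] components_homeomorphism_image[OF H]
      by (auto simp: linked_pairs_def inj_image_eq_iff[OF inj])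
  qed
qed

lemma simple_closed_polygon_compact: "simple_closed_polygon C \<Longrightarrow> compact C"
  unfolding simple_closed_polygon_def using compact_simple_path_image by blast

text \<open>A linked pair \<open>(A, B)\<close> forces a crossing with \<open>A\<close> above \<open>B\<close>. Distinct pairs use distinct crossings,
since the two points over a crossing determine the upper and the lower component.\<close>

lemma card_linked_pairs_le_crossings:
  assumes "regular_diagram D"
  shows "card (linked_pairs D) \<le> card (crossings D)"
proof -
  have comp: "finite (components D)" "\<And>C. C \<in> components D \<Longrightarrow> compact C"
    and fin: "finite (crossings D)"
    and double: "\<And>p. p \<in> crossings D \<Longrightarrow> card {x\<in>D. plane_proj x = p} = 2"
    using assms simple_closed_polygon_compact
    by (auto simp: regular_diagram_def polygonal_link_def)
  let ?over = "\<lambda>(A, B) p. \<exists>x\<in>A. \<exists>y\<in>B. lies_below y x \<and> plane_proj x = p"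
  have ex: "\<exists>p. ?over P p" if "P \<in> linked_pairs D" for P
  proof -
    obtain A B where P: "P = (A, B)" "A \<in> components D" "B \<in> components D" "A \<noteq> B"
      "\<not> shrinks_in A (- B)" using \<open>P \<in> linked_pairs D\<close> by (auto simp: linked_pairs_def)
    then have "A \<inter> B = {}" by (metis components_nonoverlap)
    then have "\<exists>x\<in>A. \<exists>y\<in>B. lies_below y x"
      using shrinks_in_complement_if_nowhere_above[of A B] P comp(2) compact_imp_bounded by blast
    then show ?thesis using P(1) by fastforce
  qed
  define f where "f P = (SOME p. ?over P p)" for P
  have f: "?over P (f P)" if "P \<in> linked_pairs D" for P
    unfolding f_def using ex[OF that] by (rule someI_ex)
  show ?thesis
  proof (rule card_inj_on_le[of f])
    show "f ` linked_pairs D \<subseteq> crossings D"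
    proof
      fix p assume "p \<in> f ` linked_pairs D"
      then obtain A B where AB: "(A, B) \<in> linked_pairs D" "p = f (A, B)" by auto
      with f[OF AB(1)] obtain x y where "x \<in> A" "y \<in> B" "lies_below y x" "plane_proj x = p" by auto
      moreover have "A \<subseteq> D" "B \<subseteq> D" using AB by (auto simp: linked_pairs_def in_components_subset)
      moreover have "x \<noteq> y" "plane_proj y = p"
        using \<open>lies_below y x\<close> \<open>plane_proj x = p\<close> by (auto simp: lies_below_def)
      ultimately show "p \<in> crossings D"
        unfolding crossings_def by blast
    qed
    then have cr: "f P \<in> crossings D" if "P \<in> linked_pairs D" for P using that by auto
    show "inj_on f (linked_pairs D)"
    proof (rule inj_onI)
      fix P Q assume PQ: "P \<in> linked_pairs D" "Q \<in> linked_pairs D" "f P = f Q"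
      obtain A B A' B' where AB: "P = (A, B)" "Q = (A', B')" by (metis surj_pair)
      have comps: "A \<in> components D" "B \<in> components D" "A' \<in> components D" "B' \<in> components D"
        using PQ AB by (auto simp: linked_pairs_def)
      from f[OF PQ(1)] obtain x y where xy: "x \<in> A" "y \<in> B" "lies_below y x" "plane_proj x = f P"
        using AB by auto
      from f[OF PQ(2)] obtain x' y' where xy': "x' \<in> A'" "y' \<in> B'" "lies_below y' x'" "plane_proj x' = f P"
        using AB PQ(3) by auto
      let ?F = "{x\<in>D. plane_proj x = f P}"
      have D: "x \<in> D" "y \<in> D" "x' \<in> D" "y' \<in> D"
        using comps xy xy' in_components_subset by blast+
      have "x \<noteq> y" "x' \<noteq> y'" using xy xy' by (auto simp: lies_below_def)
      moreover have F: "x \<in> ?F" "y \<in> ?F" "x' \<in> ?F" "y' \<in> ?F"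
        using xy xy' D by (auto simp: lies_below_def)
      moreover obtain u v where "?F = {u, v}"
        using double[OF cr[OF PQ(1)]] by (meson card_2_iff)
      ultimately have "(x = x' \<and> y = y') \<or> (x = y' \<and> y = x')" by auto
      then have "x = x'" "y = y'" using xy(3) xy'(3) by (auto simp: lies_below_def)
      then show "P = Q"
        using xy xy' comps AB by (metis IntI components_eq empty_iff)
    qed
  qed (rule fin)
qed

lemma ambient_isotopic_refl: "ambient_isotopic A A"
  unfolding ambient_isotopic_def
  by (rule exI[of _ snd]) (auto intro!: continuous_intros exI[of _ id] simp: homeomorphism_def)

lemma ambient_isotopic_homeomorphism:
  assumes "ambient_isotopic A B"
  obtains H K where "homeomorphism UNIV UNIV H K" "H ` A = B"
  using assms unfolding ambient_isotopic_def by (metis atLeastAtMost_iff order_refl zero_le_one)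

lemma minimal_diagram_if_crossings_le_linked_pairs:
  assumes D: "regular_diagram D" and le: "card (crossings D) \<le> card (linked_pairs D)"
  shows "minimal_diagram_of D D"
  unfolding minimal_diagram_of_def diagram_of_def
proof (intro conjI allI impI D ambient_isotopic_refl)
  fix D' assume D': "regular_diagram D' \<and> ambient_isotopic D' D"
  then obtain H K where H: "homeomorphism UNIV UNIV H K" "H ` D' = D"
    using ambient_isotopic_homeomorphism by blast
  have "homeomorphism UNIV UNIV K H" "K ` D = D'"
    using H by (auto simp: homeomorphism_def image_image)
  then have "card (linked_pairs D) \<le> card (linked_pairs D')"
    using card_linked_pairs_homeomorphism_image[of K H D] D'
    by (auto simp: regular_diagram_def polygonal_link_def)
  then show "card (crossings D) \<le> card (crossings D')"
    using le card_linked_pairs_le_crossings[of D'] D' by linarith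
qed

text \<open>A tame sphere is the image of the unit sphere under a homeomorphism of space, which takes the open unit ball
to the inside. So the inside of \<open>S\<close> is contractible, contains \<open>A\<close> and misses \<open>B\<close>.\<close>

lemma shrinks_in_if_separated_by_sphere:
  fixes A B :: "(real^3) set"
  assumes S: "ambient_isotopic (sphere 0 1) S" and A: "A \<subseteq> inside S" and B: "B \<subseteq> outside S"
  shows "shrinks_in A (- B)"
proof -
  obtain H K where H: "homeomorphism UNIV UNIV H K" "H ` sphere (0::real^3) 1 = S"
    using S by (rule ambient_isotopic_homeomorphism)
  have KH: "K (H x) = x" "H (K y) = y" for x y
    using H(1) by (auto simp: homeomorphism_def)
  have cont: "continuous_on X H" "continuous_on X K" for X
    using H(1) continuous_on_subset by (auto simp: homeomorphism_def)
  have bdd: "bounded (H ` cball 0 1)"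
    by (intro compact_imp_bounded compact_continuous_image cont compact_cball)
  have "inside S \<subseteq> H ` ball 0 1"
  proof
    fix x assume x: "x \<in> inside S"
    show "x \<in> H ` ball 0 1"
    proof (rule ccontr)
      assume "x \<notin> H ` ball 0 1"
      moreover have "x \<notin> S" using x by (auto simp: inside_def)
      ultimately have "H (K x) \<notin> H ` ball 0 1" "H (K x) \<notin> H ` sphere 0 1"
        using H(2) by (simp_all only: KH not_False_eq_True)
      then have "K x \<notin> ball 0 1" "K x \<notin> sphere 0 1" by blast+
      then have "K x \<notin> cball 0 1" by simp
      then have "x \<in> H ` (- cball 0 1)" by (metis ComplI KH(2) imageI)
      moreover have "connected (H ` (- cball 0 1))"
        by (intro connected_continuous_image cont connected_complement_bounded_convex) auto
      moreover have "H ` (- cball 0 1) \<subseteq> - S"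
        using H(2) by (auto, metis KH(1) dual_order.refl mem_sphere_0)
      ultimately have "H ` (- cball 0 1) \<subseteq> connected_component_set (- S) x"
        by (simp add: connected_component_maximal)
      moreover have "bounded (connected_component_set (- S) x)"
        using x by (simp add: inside_def)
      ultimately have "bounded (H ` (- cball 0 1) \<union> H ` cball 0 1)"
        using bdd bounded_subset by auto
      moreover have "H ` (- cball 0 1) \<union> H ` cball 0 1 = UNIV"
        using H(1) by (simp add: image_Un[symmetric] homeomorphism_def)
      ultimately show False by simp
    qed
  qed
  moreover have "y \<notin> H ` ball 0 1" if y: "y \<in> outside S" for y
  proof
    assume yb: "y \<in> H ` ball 0 1"
    let ?C = "connected_component_set (- S) y"
    have "y \<in> - S" using y by (auto simp: outside_def)
    then have "y \<in> ?C" by (simp add: connected_component_refl)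
    moreover have "K y \<in> ball 0 1" using yb by (auto simp: KH)
    ultimately have "K ` ?C \<inter> ball 0 1 \<noteq> {}" by blast
    moreover have "connected (K ` ?C)"
      by (intro connected_continuous_image cont connected_connected_component)
    moreover have "K ` ?C \<inter> frontier (ball 0 1) = {}"
    proof -
      have "z \<notin> sphere 0 1" if "z \<in> K ` ?C" for z
      proof
        assume "z \<in> sphere 0 1"
        then have "H z \<in> S" using H(2) by blast
        moreover have "H z \<in> ?C" using that by (auto simp: KH)
        ultimately show False using connected_component_subset[of "- S" y] by blast
      qed
      then show ?thesis by auto
    qed
    ultimately have "K ` ?C \<subseteq> ball 0 1"
      using connected_Int_frontier[of "K ` ?C" "ball 0 1"] by blast
    then have "H ` K ` ?C \<subseteq> H ` cball 0 1"
      using ball_subset_cball[of 0 1] by blast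
    then have "?C \<subseteq> H ` cball 0 1"
      by (simp add: image_image KH)
    then have "bounded ?C" using bdd bounded_subset by blast
    then show False using y by (simp add: outside_def)
  qed
  moreover have "contractible (H ` ball 0 1)"
  proof -
    have "ball (0::real^3) 1 homeomorphic (H ` ball (0::real^3) 1)"
      unfolding homeomorphic_def homeomorphism_def
      by (rule exI[of _ H], rule exI[of _ K]) (auto simp: image_image KH cont)
    then show ?thesis
      using homeomorphic_contractible convex_imp_contractible convex_ball by blast
  qed
  ultimately show ?thesis
    using shrinks_in_through_contractible[of A "H ` ball 0 1" "- B"] A B by blast
qed


section \<open>Square rings in tilted planes\<close>

definition square :: "real \<Rightarrow> real \<Rightarrow> complex set" where
  "square a b = {z. Re z \<in> {a..b} \<and> Im z \<in> {a..b} \<and> (Re z \<in> {a, b} \<or> Im z \<in> {a, b})}"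

definition clamp01 :: "real \<Rightarrow> real" where
  "clamp01 u = max 0 (min 1 u)"

text \<open>The square is traversed clockwise from \<open>(a, a)\<close>, one side per unit of time: left, top, right, bottom.
The times \<open>[0, 2]\<close> are spent above the diagonal and \<open>[2, 4]\<close> below it, and reflection in the diagonal is
\<open>t \<mapsto> 4 - t\<close>.\<close>

definition perimeter :: "real \<Rightarrow> real \<Rightarrow> real \<Rightarrow> complex" where
  "perimeter a b t = Complex (a + (b - a) * (clamp01 (t - 1) - clamp01 (t - 3)))
                             (a + (b - a) * (clamp01 t - clamp01 (t - 2)))"

definition lift :: "real \<Rightarrow> complex \<Rightarrow> real^3" where
  "lift s z = vector [Re z, Im z, s * (Im z - Re z)]"

definition ring :: "real \<Rightarrow> real \<Rightarrow> real \<Rightarrow> (real^3) set" where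
  "ring a b s = lift s ` square a b"

lemma continuous_on_perimeter: "continuous_on A (perimeter a b)"
  unfolding perimeter_def Complex_eq clamp01_def by (intro continuous_intros)

lemma perimeter_left: "0 \<le> w \<Longrightarrow> w \<le> 1 \<Longrightarrow> perimeter a b w = Complex a (a + (b - a) * w)"
  by (simp add: perimeter_def clamp01_def)

lemma perimeter_top: "0 \<le> w \<Longrightarrow> w \<le> 1 \<Longrightarrow> perimeter a b (1 + w) = Complex (a + (b - a) * w) b"
  by (simp add: perimeter_def clamp01_def max_def min_def)

lemma perimeter_mirror:
  "perimeter a b (4 - t) = Complex (Im (perimeter a b t)) (Re (perimeter a b t))"
  by (auto simp: perimeter_def clamp01_def max_def min_def algebra_simps)

lemma perimeter_ends: "perimeter a b 0 = Complex a a" "perimeter a b 4 = Complex a a"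
    "perimeter a b 2 = Complex b b"
  by (simp_all add: perimeter_def clamp01_def)

lemma perimeter_upper_cases:
  fixes t :: real
  assumes "0 \<le> t" "t \<le> 2"
  obtains w where "0 \<le> w" "w \<le> 1" "t = w \<or> t = 1 + w"
  using assms by (cases "t \<le> 1") (auto intro: that[of t] that[of "t - 1"])

lemma perimeter_upper:
  assumes "a < b" "0 \<le> t" "t \<le> 2"
  shows "Re (perimeter a b t) \<le> Im (perimeter a b t)"
proof -
  obtain w where w: "0 \<le> w" "w \<le> 1" "t = w \<or> t = 1 + w"
    using assms(2,3) by (rule perimeter_upper_cases)
  have "(b - a) * w \<le> (b - a) * 1" "0 \<le> (b - a) * w"
    using w assms(1) by (intro mult_left_mono mult_nonneg_nonneg; simp)+
  then show ?thesis using w by (auto simp: perimeter_left perimeter_top)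
qed

lemma perimeter_lower:
  assumes "a < b" "2 \<le> t" "t \<le> 4"
  shows "Im (perimeter a b t) \<le> Re (perimeter a b t)"
  using perimeter_upper[of a b "4 - t"] assms by (simp add: perimeter_mirror)

lemma square_mirror: "Complex (Im z) (Re z) \<in> square a b \<longleftrightarrow> z \<in> square a b"
  by (auto simp: square_def)

lemma perimeter_in_square:
  assumes "a < b" "0 \<le> t" "t \<le> 4"
  shows "perimeter a b t \<in> square a b"
proof -
  have up: "perimeter a b t \<in> square a b" if t: "0 \<le> t" "t \<le> 2" for t
  proof -
    obtain w where w: "0 \<le> w" "w \<le> 1" "t = w \<or> t = 1 + w"
      using t by (rule perimeter_upper_cases)
    have "(b - a) * w \<le> (b - a) * 1" "0 \<le> (b - a) * w"
      using w assms(1) by (intro mult_left_mono mult_nonneg_nonneg; simp)+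
    then have "a + (b - a) * w \<le> b" "a \<le> a + (b - a) * w" by simp_all
    then show ?thesis using w assms(1) by (auto simp: perimeter_left perimeter_top square_def)
  qed
  show ?thesis
  proof (cases "t \<le> 2")
    case False
    have "perimeter a b (4 - t) \<in> square a b" using False assms by (intro up) auto
    then show ?thesis by (simp add: perimeter_mirror square_mirror)
  qed (use up assms in auto)
qed

lemma square_upper_param:
  assumes "a < b" "z \<in> square a b" "Re z < Im z"
  obtains t where "0 < t" "t < 2" "perimeter a b t = z"
proof (cases "Re z = a")
  case True
  let ?w = "(Im z - a) / (b - a)"
  have w: "0 < ?w" "?w \<le> 1" using assms True by (auto simp: square_def)
  have "perimeter a b ?w = z"
    using w assms(1) True by (subst perimeter_left) (auto simp: complex_eq_iff)
  then show ?thesis using that[of ?w] w by simp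
next
  case False
  then have Im: "Im z = b" using assms by (auto simp: square_def)
  let ?w = "(Re z - a) / (b - a)"
  have w: "0 \<le> ?w" "?w < 1" using assms Im by (auto simp: square_def)
  have "perimeter a b (1 + ?w) = z"
    using w assms(1) Im by (subst perimeter_top) (auto simp: complex_eq_iff)
  then show ?thesis using that[of "1 + ?w"] w by simp
qed

lemma perimeter_image: 
  assumes "a < b"
  shows "perimeter a b ` {0..4} = square a b"
proof
  show "perimeter a b ` {0..4} \<subseteq> square a b"
    using perimeter_in_square[OF assms] by auto
  show "square a b \<subseteq> perimeter a b ` {0..4}"
  proof
    fix z assume z: "z \<in> square a b"
    consider "Re z < Im z" | "Im z < Re z" | "Re z = Im z" by linarith
    then show "z \<in> perimeter a b ` {0..4}"
    proof cases
      case 1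
      then obtain t where "0 < t" "t < 2" "perimeter a b t = z"
        using square_upper_param[OF assms z] by metis
      then show ?thesis by (intro image_eqI[of _ _ t]) auto
    next
      case 2
      have "Complex (Im z) (Re z) \<in> square a b" using z by (simp add: square_mirror)
      then obtain t where "0 < t" "t < 2" "perimeter a b t = Complex (Im z) (Re z)"
        using square_upper_param[OF assms] 2 by (metis complex.sel)
      then show ?thesis
        by (intro image_eqI[of _ _ "4 - t"]) (auto simp: perimeter_mirror)
    next
      case 3
      then have "z = Complex a a \<or> z = Complex b b"
        using z by (auto simp: square_def complex_eq_iff)
      then have "z = perimeter a b 0 \<or> z = perimeter a b 2" by (simp add: perimeter_ends)
      then show ?thesis by auto
    qed
  qed
qed

lemma perimeter_inj:
  assumes "a < b"
  shows "inj_on (perimeter a b) {0..<4}"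
proof (rule inj_onI)
  fix t u assume tu: "t \<in> {0..<4}" "u \<in> {0..<4}" and eq: "perimeter a b t = perimeter a b u"
  have "clamp01 (t - 1) - clamp01 (t - 3) = clamp01 (u - 1) - clamp01 (u - 3)"
       "clamp01 t - clamp01 (t - 2) = clamp01 u - clamp01 (u - 2)"
    using eq assms by (auto simp: perimeter_def)
  then show "t = u"
    using tu by (auto simp: clamp01_def max_def min_def split: if_splits)
qed

lemma lift_nth [simp]: "lift s z $ 1 = Re z" "lift s z $ 2 = Im z"
    "lift s z $ 3 = s * (Im z - Re z)"
  by (simp_all add: lift_def)

lemma plane_proj_lift: "plane_proj (lift s z) = (Re z, Im z)"
  by (simp add: plane_proj_def)

lemma linear_lift: "linear (lift s)"
  by (rule linearI) (auto simp: vec_eq_iff forall_3 algebra_simps)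

lemma lift_eq_iff [simp]: "lift s z = lift s w \<longleftrightarrow> z = w"
  by (auto simp: vec_eq_iff forall_3 complex_eq_iff)

lemma continuous_on_lift: "continuous_on A (lift s)"
  using linear_lift by (simp add: linear_continuous_on linear_conv_bounded_linear)

lemma lift_linepath: "lift s \<circ> linepath z w = linepath (lift s z) (lift s w)"
  by (auto simp: fun_eq_iff linepath_def linear_add[OF linear_lift] linear_scale[OF linear_lift])

lemma square_eq_rectpath:
  assumes "a < b"
  shows "path_image (rectpath (Complex a a) (Complex b b)) = square a b"
  using assms by (auto simp: path_image_rectpath square_def)

lemma ring_simple_closed_polygon:
  assumes "a < b"
  shows "simple_closed_polygon (ring a b s)"
  unfolding simple_closed_polygon_def
proof (intro exI conjI)
  let ?r = "rectpath (Complex a a) (Complex b b)"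
  show "simple_path (lift s \<circ> ?r)"
    using assms
    by (intro simple_path_continuous_image simple_path_rectpath continuous_on_lift)
      (auto simp: inj_on_def)
  show "pathfinish (lift s \<circ> ?r) = pathstart (lift s \<circ> ?r)"
    by (simp add: pathfinish_compose pathstart_compose)
  show "path_image (lift s \<circ> ?r) = ring a b s"
    by (simp add: path_image_compose square_eq_rectpath assms ring_def)
  have "polygonal_path (linepath p q +++ linepath q r +++ linepath r t +++ linepath t p)"
    for p q r t :: "real^3"
  proof -
    have "polygonal_path (linepath r t +++ linepath t p)"
      using polygonal_path.join[OF polygonal_path.segment[of t p], of r] by simp
    from polygonal_path.join[OF this, of q]
    have "polygonal_path (linepath q r +++ linepath r t +++ linepath t p)" by simp
    from polygonal_path.join[OF this, of p] show ?thesis by simp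
  qed
  then show "polygonal_path (lift s \<circ> ?r)"
    by (simp add: rectpath_def Let_def path_compose_join lift_linepath)
qed

text \<open>Away from the corners the square is a line near each of its points; the direction \<open>d\<close> and the size \<open>e\<close> of the
neighborhood are what local straightness of the ring needs.\<close>

lemma square_locally_straight:
  assumes z: "(Re z \<in> {a, b} \<and> a < Im z \<and> Im z < b) \<or> (Im z \<in> {a, b} \<and> a < Re z \<and> Re z < b)"
  obtains e d where "e > 0" "d \<noteq> 0"
    "\<And>w. \<bar>Re w - Re z\<bar> < e \<Longrightarrow> \<bar>Im w - Im z\<bar> < e \<Longrightarrow>
       w \<in> square a b \<longleftrightarrow> (\<exists>t. w = z + t *\<^sub>R d)"
  using z
proof
  assume z: "Re z \<in> {a, b} \<and> a < Im z \<and> Im z < b"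
  let ?e = "min (Im z - a) (b - Im z)"
  show ?thesis
  proof (rule that[of ?e \<i>])
    fix w assume w: "\<bar>Re w - Re z\<bar> < ?e" "\<bar>Im w - Im z\<bar> < ?e"
    have "w \<in> square a b \<longleftrightarrow> Re w = Re z"
      using w z by (auto simp: square_def abs_less_iff)
    also have "\<dots> \<longleftrightarrow> (\<exists>t. w = z + t *\<^sub>R \<i>)"
    proof
      assume "Re w = Re z"
      then have "w = z + (Im w - Im z) *\<^sub>R \<i>" by (simp add: complex_eq_iff)
      then show "\<exists>t. w = z + t *\<^sub>R \<i>" ..
    qed auto
    finally show "w \<in> square a b \<longleftrightarrow> (\<exists>t. w = z + t *\<^sub>R \<i>)" .
  qed (use z in auto)
next
  assume z: "Im z \<in> {a, b} \<and> a < Re z \<and> Re z < b"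
  let ?e = "min (Re z - a) (b - Re z)"
  show ?thesis
  proof (rule that[of ?e 1])
    fix w assume w: "\<bar>Re w - Re z\<bar> < ?e" "\<bar>Im w - Im z\<bar> < ?e"
    have "w \<in> square a b \<longleftrightarrow> Im w = Im z"
      using w z by (auto simp: square_def abs_less_iff)
    also have "\<dots> \<longleftrightarrow> (\<exists>t. w = z + t *\<^sub>R 1)"
    proof
      assume "Im w = Im z"
      then have "w = z + (Re w - Re z) *\<^sub>R 1" by (simp add: complex_eq_iff)
      then show "\<exists>t. w = z + t *\<^sub>R 1" ..
    qed auto
    finally show "w \<in> square a b \<longleftrightarrow> (\<exists>t. w = z + t *\<^sub>R 1)" .
  qed (use z in auto)
qed

lemma ring_locally_straight:
  assumes z: "(Re z \<in> {a, b} \<and> a < Im z \<and> Im z < b) \<or> (Im z \<in> {a, b} \<and> a < Re z \<and> Re z < b)"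
    and E: "closed E" "lift s z \<notin> E"
  shows "locally_straight_at (ring a b s \<union> E) (lift s z)"
proof -
  obtain e d where e: "e > 0" and d: "d \<noteq> 0" and straight:
    "\<And>w. \<bar>Re w - Re z\<bar> < e \<Longrightarrow> \<bar>Im w - Im z\<bar> < e \<Longrightarrow>
       w \<in> square a b \<longleftrightarrow> (\<exists>t. w = z + t *\<^sub>R d)"
    using square_locally_straight[OF z] by blast
  obtain e' where e': "e' > 0" "ball (lift s z) e' \<inter> E = {}"
    using E open_contains_ball[of "- E"] by (auto simp: open_Compl disjoint_eq_subset_Compl)
  let ?r = "min e e'"
  have near: "\<bar>Re w - Re z\<bar> < e \<and> \<bar>Im w - Im z\<bar> < e" if "lift s w \<in> ball (lift s z) ?r" for w
  proof -
    have "\<bar>(lift s w - lift s z) $ i\<bar> < e" for i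
      using that component_le_norm_cart[of "lift s w - lift s z" i]
      by (simp add: dist_norm norm_minus_commute)
    from this[of 1] this[of 2] show ?thesis by simp
  qed
  have line: "lift s z + t *\<^sub>R lift s d = lift s (z + t *\<^sub>R d)" for t
    by (simp add: linear_add[OF linear_lift] linear_scale[OF linear_lift])
  have "(ring a b s \<union> E) \<inter> ball (lift s z) ?r = ring a b s \<inter> ball (lift s z) ?r"
    using e' by auto
  also have "\<dots> = range (\<lambda>t. lift s z + t *\<^sub>R lift s d) \<inter> ball (lift s z) ?r"
  proof (intro equalityI subsetI)
    fix x assume x: "x \<in> ring a b s \<inter> ball (lift s z) ?r"
    then obtain w where w: "x = lift s w" "w \<in> square a b" by (auto simp: ring_def)
    then obtain t where "w = z + t *\<^sub>R d" using x near[of w] straight[of w] by auto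
    then show "x \<in> range (\<lambda>t. lift s z + t *\<^sub>R lift s d) \<inter> ball (lift s z) ?r"
      using x w by (auto simp: line)
  next
    fix x assume x: "x \<in> range (\<lambda>t. lift s z + t *\<^sub>R lift s d) \<inter> ball (lift s z) ?r"
    then obtain t where t: "x = lift s (z + t *\<^sub>R d)" by (auto simp: line)
    then have "z + t *\<^sub>R d \<in> square a b"
      using x near[of "z + t *\<^sub>R d"] straight[of "z + t *\<^sub>R d"] by auto
    then show "x \<in> ring a b s \<inter> ball (lift s z) ?r"
      using x t by (auto simp: ring_def)
  qed
  finally have "(ring a b s \<union> E) \<inter> ball (lift s z) ?r =
      range (\<lambda>t. lift s z + t *\<^sub>R lift s d) \<inter> ball (lift s z) ?r" .
  moreover have "lift s d \<noteq> 0"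
    using d lift_eq_iff[of s d 0] linear_0[OF linear_lift, of s] by metis
  ultimately show ?thesis
    unfolding locally_straight_at_def using e e'(1)
    by (intro exI[of _ ?r] conjI exI[of _ "lift s d"]) auto
qed

text \<open>On the closed upper half-plane without \<open>0\<close> the function \<open>Ln (- \<i> z)\<close> is continuous, because \<open>- \<i> z\<close> stays
in the right half-plane. Any continuous logarithm of \<open>F\<close> differs from it by a constant, so its
imaginary part drops by \<open>\<pi>\<close> from the negative to the positive real axis.\<close>

lemma continuous_logarithm_change_upper_half_plane:
  fixes F G :: "real \<Rightarrow> complex"
  assumes S: "connected S" "p \<in> S" "q \<in> S"
    and G: "continuous_on S G" "\<And>t. t \<in> S \<Longrightarrow> F t = exp (G t)"
    and up: "\<And>t. t \<in> S \<Longrightarrow> 0 \<le> Im (F t)"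
    and ends: "Im (F p) = 0" "Re (F p) < 0" "Im (F q) = 0" "Re (F q) > 0"
  shows "Im (G q) = Im (G p) - pi"
proof -
  have slit: "- \<i> * F t \<notin> \<real>\<^sub>\<le>\<^sub>0" if "t \<in> S" for t
  proof
    assume "- \<i> * F t \<in> \<real>\<^sub>\<le>\<^sub>0"
    then have "F t = 0"
      using up[OF that] by (auto simp: complex_nonpos_Reals_iff complex_eq_iff)
    then show False using G(2)[OF that] by simp
  qed
  let ?k = "\<lambda>t. G t - Ln (- \<i> * F t)"
  have "continuous_on S F"
    using continuous_on_cong[of S S F "\<lambda>t. exp (G t)"] G by (auto intro!: continuous_intros)
  then have "continuous_on S ?k"
    using G(1) slit by (intro continuous_intros) auto
  moreover have exp_k: "exp (?k t) = \<i>" if "t \<in> S" for t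
  proof -
    have "F t \<noteq> 0" using G(2)[OF that] by simp
    then show ?thesis using G(2)[OF that] by (simp add: exp_diff field_simps)
  qed
  have "\<exists>e>0. \<forall>y. y \<in> S \<and> ?k y \<noteq> ?k x \<longrightarrow> e \<le> norm (?k y - ?k x)" if "x \<in> S" for x
  proof (intro exI[of _ "2 * pi"] conjI allI impI)
    fix y assume y: "y \<in> S \<and> ?k y \<noteq> ?k x"
    then have "exp (?k y) = exp (?k x)" using exp_k that by simp
    then obtain n :: int where n: "?k y = ?k x + (of_int (2 * n) * pi) * \<i>"
      unfolding exp_eq by blast
    then have "n \<noteq> 0" using y by auto
    then have "1 \<le> \<bar>real_of_int n\<bar>" by linarith
    have "?k y - ?k x = of_real (real_of_int (2 * n) * pi) * \<i>"
      using n by simp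
    then have "norm (?k y - ?k x) = \<bar>real_of_int (2 * n) * pi\<bar>"
      by (simp only: norm_mult norm_of_real norm_ii mult_1_right)
    also have "\<dots> = 2 * pi * \<bar>real_of_int n\<bar>" by (simp add: abs_mult)
    finally show "2 * pi \<le> norm (?k y - ?k x)"
      using \<open>1 \<le> \<bar>real_of_int n\<bar>\<close> by simp
  qed simp
  ultimately have "?k constant_on S"
    using continuous_discrete_range_constant[OF S(1)] by blast
  then have "?k p = ?k q" using S(2,3) by (auto simp: constant_on_def)
  moreover have Im_Ln: "Im (Ln (w)) = Im (Ln z)" if "w = of_real r * z" "r > 0" "z \<noteq> 0" for w z r
    using that by (simp add: Ln_times_of_real Ln_of_real)
  have "Im (Ln (- \<i> * F p)) = Im (Ln \<i>)"
    by (rule Im_Ln[of _ "- Re (F p)"]) (use ends in \<open>auto simp: complex_eq_iff\<close>)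
  moreover have "Im (Ln (- \<i> * F q)) = Im (Ln (- \<i>))"
    by (rule Im_Ln[of _ "Re (F q)"]) (use ends in \<open>auto simp: complex_eq_iff\<close>)
  ultimately have "Im (G p) - Im (Ln \<i>) = Im (G q) - Im (Ln (- \<i>))"
    by (simp add: complex_eq_iff)
  then show ?thesis by simp
qed

text \<open>The loop crosses the upper half-plane from one side of the real axis to the other and comes back through
the lower half-plane. Both halves change the argument by \<open>\<pi>\<close> in the same direction, so the argument
does not return to its initial value.\<close>

lemma no_continuous_logarithm_of_winding_loop:
  fixes F G :: "real \<Rightarrow> complex"
  assumes G: "continuous_on {0..4} G" "\<And>t. t \<in> {0..4} \<Longrightarrow> F t = exp (G t)" "G 0 = G 4"
    and up: "\<And>t. t \<in> {0..2} \<Longrightarrow> 0 \<le> Im (F t)"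
    and low: "\<And>t. t \<in> {2..4} \<Longrightarrow> Im (F t) \<le> 0"
    and ends: "Re (F 0) * Re (F 2) < 0"
  shows False
proof -
  have "F 0 = F 4" using G by simp
  then have real: "Im (F 0) = 0" "Im (F 2) = 0" "Im (F 4) = 0"
    using up[of 0] up[of 2] low[of 2] low[of 4] by auto
  have cont: "continuous_on {0..2} G" "continuous_on {2..4} G"
    "continuous_on {0..2} (\<lambda>t. cnj (G t))" "continuous_on {2..4} (\<lambda>t. cnj (G t))"
    by (auto intro!: continuous_intros continuous_on_subset[OF G(1)])
  consider "Re (F 0) < 0" "0 < Re (F 2)" | "0 < Re (F 0)" "Re (F 2) < 0"
    using ends by (auto simp: mult_less_0_iff)
  then show False
  proof cases
    case 1
    have "Im (G 2) = Im (G 0) - pi"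
      by (rule continuous_logarithm_change_upper_half_plane[of "{0..2}" _ _ _ F])
        (use 1 real cont G up in auto)
    \<comment> \<open>conjugation carries the second half of the loop to the upper half-plane\<close>
    moreover have "Im (cnj (G 2)) = Im (cnj (G 4)) - pi"
      by (rule continuous_logarithm_change_upper_half_plane[of "{2..4}" _ _ _ "\<lambda>t. cnj (F t)"])
        (use 1 real cont G low \<open>F 0 = F 4\<close> in \<open>auto simp: exp_cnj[symmetric]\<close>)
    ultimately show False using G(3) pi_gt_zero by simp
  next
    case 2
    have "Im (G 0) = Im (G 2) - pi"
      by (rule continuous_logarithm_change_upper_half_plane[of "{0..2}" _ _ _ F])
        (use 2 real cont G up in auto)
    moreover have "Im (cnj (G 4)) = Im (cnj (G 2)) - pi"
      by (rule continuous_logarithm_change_upper_half_plane[of "{2..4}" _ _ _ "\<lambda>t. cnj (F t)"])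
        (use 2 real cont G low \<open>F 0 = F 4\<close> in \<open>auto simp: exp_cnj[symmetric]\<close>)
    ultimately show False using G(3) pi_gt_zero by simp
  qed
qed

definition interleaved :: "real \<Rightarrow> real \<Rightarrow> real \<Rightarrow> real \<Rightarrow> bool" where
  "interleaved a b c d \<longleftrightarrow> a < c \<and> c < b \<and> b < d \<or> c < a \<and> a < d \<and> d < b"

text \<open>The ring \<open>ring c d s'\<close> is the zero set of \<open>f\<close> below: the real part of \<open>f\<close> measures the signed
sup-distance to the square, the imaginary part the height above the plane of the ring. If the inclusion of
\<open>ring a b s\<close> were null-homotopic, \<open>f\<close> would have a continuous logarithm on it. But the real part has
opposite signs at the two corners on the diagonal, because exactly one of them is inside the square
over \<open>[c, d]\<close>, and the imaginary part is \<open>(s - s') (y - x)\<close>: the ring winds once around \<open>0\<close>.\<close>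

lemma interleaved_rings_linked:
  assumes il: "interleaved a b c d" and s: "s \<noteq> s'"
  shows "\<not> shrinks_in (ring a b s) (- ring c d s')"
proof
  assume shrinks: "shrinks_in (ring a b s) (- ring c d s')"
  have ab: "a < b" "c < d" using il by (auto simp: interleaved_def)
  define m r where "m = (c + d) / 2" and "r = (d - c) / 2"
  define f :: "real^3 \<Rightarrow> complex" where
    "f x = Complex (max \<bar>x $ 1 - m\<bar> \<bar>x $ 2 - m\<bar> - r) (x $ 3 - s' * (x $ 2 - x $ 1))" for x
  have "x \<in> ring c d s'" if "f x = 0" for x
  proof -
    have x: "max \<bar>x $ 1 - m\<bar> \<bar>x $ 2 - m\<bar> = r" "x $ 3 = s' * (x $ 2 - x $ 1)"
      using that by (auto simp: f_def complex_eq_iff)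
    have "Complex (x $ 1) (x $ 2) \<in> square c d"
      using x(1) by (auto simp: square_def m_def r_def max_def abs_if field_simps split: if_splits)
    moreover have "x = lift s' (Complex (x $ 1) (x $ 2))"
      using x(2) by (simp add: vec_eq_iff forall_3)
    ultimately show ?thesis unfolding ring_def by blast
  qed
  then have f: "f \<in> - ring c d s' \<rightarrow> - {0}" by blast
  have contf: "continuous_on A f" for A
    unfolding f_def Complex_eq by (intro continuous_intros)
  obtain p where "homotopic_with_canon (\<lambda>_. True) (ring a b s) (- ring c d s') id (\<lambda>_. p)"
    using shrinks by (auto simp: shrinks_in_def)
  then have "homotopic_with_canon (\<lambda>_. True) (ring a b s) (- {0}) (f \<circ> id) (f \<circ> (\<lambda>_. p))"
    by (rule homotopic_with_compose_continuous_left) (use contf f in auto)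
  then have "\<exists>q. homotopic_with_canon (\<lambda>_. True) (ring a b s) (- {0}) f (\<lambda>_. q)"
    by (auto simp: comp_def)
  then obtain g where g: "continuous_on (ring a b s) g" "\<And>x. x \<in> ring a b s \<Longrightarrow> f x = exp (g x)"
    unfolding inessential_eq_continuous_logarithm by blast
  let ?l = "\<lambda>t. lift s (perimeter a b t)"
  have l: "?l t \<in> ring a b s" if "t \<in> {0..4}" for t
    using perimeter_in_square[OF ab(1)] that by (auto simp: ring_def)
  have contg: "continuous_on {0..4} (\<lambda>t. g (?l t))"
    by (rule continuous_on_compose2[OF g(1)])
      (use l in \<open>auto intro!: continuous_on_compose2[OF continuous_on_lift continuous_on_perimeter]\<close>)
  have Im: "Im (f (?l t)) = (s - s') * (Im (perimeter a b t) - Re (perimeter a b t))" for t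
    by (simp add: f_def algebra_simps)
  have ends: "Re (f (?l 0)) * Re (f (?l 2)) < 0"
  proof -
    have "\<bar>x - m\<bar> - r < 0" if "c < x" "x < d" for x
      using that by (auto simp: m_def r_def abs_if field_simps)
    moreover have "0 < \<bar>x - m\<bar> - r" if "x < c \<or> d < x" for x
      using that by (auto simp: m_def r_def abs_if field_simps)
    ultimately show ?thesis
      using il ab by (auto simp: f_def perimeter_ends interleaved_def mult_less_0_iff)
  qed
  have loop: "g (?l 0) = g (?l 4)" by (simp add: perimeter_ends)
  \<comment> \<open>for s smaller than s' the loop runs the other way round, which conjugation repairs\<close>
  show False
  proof (cases "s > s'")
    case True
    show False
    proof (rule no_continuous_logarithm_of_winding_loop[of "\<lambda>t. g (?l t)" "\<lambda>t. f (?l t)"])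
      show "0 \<le> Im (f (?l t))" if "t \<in> {0..2}" for t
        using perimeter_upper[OF ab(1), of t] True that by (simp add: Im)
      show "Im (f (?l t)) \<le> 0" if "t \<in> {2..4}" for t
        using perimeter_lower[OF ab(1), of t] True that by (simp add: Im mult_le_0_iff)
    qed (use contg g(2) l loop ends in auto)
  next
    case False
    show False
    proof (rule no_continuous_logarithm_of_winding_loop[of "\<lambda>t. cnj (g (?l t))" "\<lambda>t. cnj (f (?l t))"])
      show "0 \<le> Im (cnj (f (?l t)))" if "t \<in> {0..2}" for t
        using perimeter_upper[OF ab(1), of t] False that by (simp add: Im mult_le_0_iff)
      show "Im (cnj (f (?l t))) \<le> 0" if "t \<in> {2..4}" for t
        using perimeter_lower[OF ab(1), of t] False that by (simp add: Im zero_le_mult_iff)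
      show "continuous_on {0..4} (\<lambda>t. cnj (g (?l t)))"
        using contg by (intro continuous_intros)
    qed (use g(2) l loop ends in \<open>auto simp: exp_cnj[symmetric]\<close>)
  qed
qed


section \<open>Links made of square rings\<close>

text \<open>The pieces are also relatively closed, as the union of the other pieces is open, so a connected set
cannot leave the piece that it meets.\<close>

lemma components_eq_if_open_partition:
  assumes un: "\<Union>F = M" and disj: "\<And>C C'. C \<in> F \<Longrightarrow> C' \<in> F \<Longrightarrow> C \<noteq> C' \<Longrightarrow> C \<inter> C' = {}"
    and conn: "\<And>C. C \<in> F \<Longrightarrow> connected C" and ne: "\<And>C. C \<in> F \<Longrightarrow> C \<noteq> {}"
    and op: "\<And>C. C \<in> F \<Longrightarrow> openin (top_of_set M) C"
  shows "components M = F"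
proof -
  have comp: "C \<in> components M" if C: "C \<in> F" for C
    unfolding in_components_maximal
  proof (intro conjI allI impI)
    fix K assume K: "K \<noteq> {} \<and> C \<subseteq> K \<and> K \<subseteq> M \<and> connected K"
    have "openin (top_of_set M) (\<Union>(F - {C}))" using op by (intro openin_Union) auto
    moreover have "openin (top_of_set K) (K \<inter> X)" if X: "openin (top_of_set M) X" for X
    proof -
      obtain T where T: "open T" "X = M \<inter> T" using X by (auto simp: openin_open)
      then have "K \<inter> X = K \<inter> T" using K by auto
      then show ?thesis using T by auto
    qed
    ultimately have "openin (top_of_set K) (K \<inter> \<Union>(F - {C}))" "openin (top_of_set K) (K \<inter> C)"
      using op[OF C] by blast+
    moreover have "K \<inter> \<Union>(F - {C}) = K - C" "K \<inter> C = C" using K un disj[OF C] C by auto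
    ultimately have "openin (top_of_set K) C" "closedin (top_of_set K) C"
      using K by (auto simp: closedin_def)
    then show "K = C" using K ne[OF C] by (metis connected_clopen)
  qed (use C un conn ne in auto)
  moreover have "K \<in> F" if K: "K \<in> components M" for K
  proof -
    obtain x where "x \<in> K" using in_components_nonempty[OF K] by auto
    then obtain C where "C \<in> F" "x \<in> C" using in_components_subset[OF K] un by auto
    then have "K = C" using components_eq[OF K comp] \<open>x \<in> K\<close> by auto
    then show ?thesis using \<open>C \<in> F\<close> by simp
  qed
  ultimately show ?thesis by blast
qed

text \<open>Nested or disjoint intervals give nested or disjoint squares with disjoint boundaries; interleaved
intervals give squares that overlap in a corner, whose boundaries cross twice.\<close>

lemma squares_Int:
  assumes "a < b" "c < d" "a \<noteq> c" "b \<noteq> d" "a \<noteq> d" "b \<noteq> c"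
  shows "z \<in> square a b \<and> z \<in> square c d \<longleftrightarrow>
    interleaved a b c d \<and> (z = Complex (max a c) (min b d) \<or> z = Complex (min b d) (max a c))"
    (is "?L \<longleftrightarrow> ?R")
proof
  assume ?L
  then show ?R using assms
    by (auto simp: square_def interleaved_def complex_eq_iff max_def min_def)
next
  assume ?R
  then show ?L using assms
    by (auto simp: square_def interleaved_def max_def min_def)
qed

text \<open>Distinct end points keep three squares from passing through one point and keep corners away from
crossings. Slopes have to differ only where two rings actually cross.\<close>

locale square_system =
  fixes I :: "'i set" and a b s :: "'i \<Rightarrow> real"
  assumes finite_I: "finite I" and nonempty_I: "I \<noteq> {}"
    and a_less_b: "\<And>i. i \<in> I \<Longrightarrow> a i < b i"
    and ends_distinct: "\<And>i j. i \<in> I \<Longrightarrow> j \<in> I \<Longrightarrow> i \<noteq> j \<Longrightarrow> a i \<noteq> a j \<and> b i \<noteq> b j \<and> a i \<noteq> b j"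
    and slopes_distinct: "\<And>i j. i \<in> I \<Longrightarrow> j \<in> I \<Longrightarrow> interleaved (a i) (b i) (a j) (b j) \<Longrightarrow> s i \<noteq> s j"
begin

definition R :: "'i \<Rightarrow> (real^3) set" where
  "R i = ring (a i) (b i) (s i)"

definition D :: "(real^3) set" where
  "D = (\<Union>i\<in>I. R i)"

definition crosses :: "'i \<Rightarrow> 'i \<Rightarrow> bool" where
  "crosses i j \<longleftrightarrow> i \<in> I \<and> j \<in> I \<and> interleaved (a i) (b i) (a j) (b j)"

text \<open>The crossing of two rings that lies above the diagonal; its mirror image is the crossing below the
diagonal.\<close>

definition upper :: "'i \<Rightarrow> 'i \<Rightarrow> complex" where
  "upper i j = Complex (max (a i) (a j)) (min (b i) (b j))"

definition lower :: "'i \<Rightarrow> 'i \<Rightarrow> complex" where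
  "lower i j = Complex (min (b i) (b j)) (max (a i) (a j))"

lemma crosses_sym: "crosses i j \<Longrightarrow> crosses j i"
  by (auto simp: crosses_def interleaved_def)

lemma crosses_in: "crosses i j \<Longrightarrow> i \<in> I" "crosses i j \<Longrightarrow> j \<in> I"
  by (auto simp: crosses_def)

lemma crosses_neq: "crosses i j \<Longrightarrow> i \<noteq> j"
  by (auto simp: crosses_def interleaved_def)

lemma crosses_slopes: "crosses i j \<Longrightarrow> s i \<noteq> s j"
  using slopes_distinct by (auto simp: crosses_def)

lemma upper_sym: "upper i j = upper j i" and lower_sym: "lower i j = lower j i"
  by (auto simp: upper_def lower_def max.commute min.commute)

lemma crosses_upper_less: "crosses i j \<Longrightarrow> Re (upper i j) < Im (upper i j)"
  using a_less_b[of i] a_less_b[of j]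
  by (auto simp: crosses_def interleaved_def upper_def)

lemma crosses_lower_less: "crosses i j \<Longrightarrow> Im (lower i j) < Re (lower i j)"
  using crosses_upper_less[of i j] by (auto simp: upper_def lower_def)

lemma in_two_squares_iff:
  assumes "i \<in> I" "j \<in> I" "i \<noteq> j"
  shows "z \<in> square (a i) (b i) \<and> z \<in> square (a j) (b j) \<longleftrightarrow>
    crosses i j \<and> (z = upper i j \<or> z = lower i j)"
  using squares_Int[of "a i" "b i" "a j" "b j" z] assms a_less_b ends_distinct[of i j] ends_distinct[of j i]
  by (auto simp: crosses_def upper_def lower_def)

lemma lift_in_R: "z \<in> square (a i) (b i) \<Longrightarrow> lift (s i) z \<in> R i"
  by (auto simp: R_def ring_def)

text \<open>A common point would lie over a crossing of the squares, which is off the diagonal, and there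
different slopes give different heights.\<close>

lemma R_disjoint:
  assumes "i \<in> I" "j \<in> I" "i \<noteq> j"
  shows "R i \<inter> R j = {}"
proof (rule ccontr)
  assume "R i \<inter> R j \<noteq> {}"
  then obtain z w where zw: "z \<in> square (a i) (b i)" "w \<in> square (a j) (b j)" "lift (s i) z = lift (s j) w"
    by (auto simp: R_def ring_def)
  then have "z = w" "s i * (Im z - Re z) = s j * (Im z - Re z)"
    by (auto simp: vec_eq_iff forall_3 complex_eq_iff)
  then have cr: "crosses i j" "z = upper i j \<or> z = lower i j" and "s i = s j \<or> Im z = Re z"
    using zw in_two_squares_iff[OF assms] by auto
  then show False
    using crosses_slopes crosses_upper_less crosses_lower_less by fastforce
qed

lemma R_simple_closed_polygon: "i \<in> I \<Longrightarrow> simple_closed_polygon (R i)"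
  using ring_simple_closed_polygon a_less_b by (auto simp: R_def)

lemma R_connected: "i \<in> I \<Longrightarrow> connected (R i)"
  using R_simple_closed_polygon connected_simple_path_image
  unfolding simple_closed_polygon_def by metis

lemma R_compact: "i \<in> I \<Longrightarrow> compact (R i)"
  using R_simple_closed_polygon simple_closed_polygon_compact by auto

lemma R_nonempty: "i \<in> I \<Longrightarrow> R i \<noteq> {}"
  using perimeter_in_square[of "a i" "b i" 0] a_less_b[of i] by (auto simp: R_def ring_def)

lemma inj_on_R: "inj_on R I"
  using R_disjoint R_nonempty by (metis inf.idem inj_onI)

lemma closed_others: "closed (\<Union>j\<in>I - {i}. R j)"
  using finite_I R_compact by (intro closed_UN) (auto intro: compact_imp_closed)

lemma R_Int_others: "i \<in> I \<Longrightarrow> R i \<inter> (\<Union>j\<in>I - {i}. R j) = {}"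
  using R_disjoint by auto

lemma D_eq: "i \<in> I \<Longrightarrow> D = R i \<union> (\<Union>j\<in>I - {i}. R j)"
  by (auto simp: D_def)

lemma components_D: "components D = R ` I"
proof (rule components_eq_if_open_partition)
  fix C assume "C \<in> R ` I"
  then obtain i where i: "i \<in> I" "C = R i" by auto
  then have "C = D \<inter> - (\<Union>j\<in>I - {i}. R j)"
    using D_eq[OF i(1)] R_Int_others[OF i(1)] by blast
  then show "openin (top_of_set D) C" using closed_others[of i] unfolding openin_open by blast
qed (use R_disjoint R_connected R_nonempty in \<open>auto simp: D_def\<close>)

lemma polygonal_link_D: "polygonal_link D"
  using nonempty_I R_nonempty finite_I R_simple_closed_polygon components_eq_empty[of D]
  by (auto simp: polygonal_link_def components_D)

text \<open>Points of two rings with the same projection are lifts of a common point of the two squares, and one ring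
never lies above itself because \<open>lift s\<close> is a section of the projection.\<close>

lemma two_strands_iff:
  assumes "x \<in> D" "y \<in> D"
  shows "x \<noteq> y \<and> plane_proj x = plane_proj y \<longleftrightarrow>
    (\<exists>i j z. crosses i j \<and> (z = upper i j \<or> z = lower i j) \<and> x = lift (s i) z \<and> y = lift (s j) z)"
    (is "?L \<longleftrightarrow> ?R")
proof
  assume L: ?L
  from assms obtain i j z w where ij: "i \<in> I" "j \<in> I" and zw: "z \<in> square (a i) (b i)"
    "x = lift (s i) z" "w \<in> square (a j) (b j)" "y = lift (s j) w"
    by (auto simp: D_def R_def ring_def)
  then have "z = w" using L by (auto simp: plane_proj_lift complex_eq_iff)
  then have "i \<noteq> j" using L zw by auto
  then show ?R using in_two_squares_iff[OF ij, of z] zw \<open>z = w\<close> by auto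
next
  assume ?R
  then obtain i j z where ij: "crosses i j" "z = upper i j \<or> z = lower i j"
    and "x = lift (s i) z" "y = lift (s j) z" by auto
  moreover have "x \<in> R i" "y \<in> R j"
    using in_two_squares_iff[OF crosses_in[OF ij(1)] crosses_neq[OF ij(1)], of z] ij
    by (auto simp: \<open>x = _\<close> \<open>y = _\<close> lift_in_R)
  ultimately show ?L
    using R_disjoint[OF crosses_in[OF ij(1)] crosses_neq[OF ij(1)]]
    by (auto simp: plane_proj_lift)
qed

lemma crossing_points_in_D:
  assumes "crosses i j" "z = upper i j \<or> z = lower i j"
  shows "lift (s i) z \<in> D" "lift (s j) z \<in> D"
  using in_two_squares_iff[OF crosses_in[OF assms(1)] crosses_neq[OF assms(1)], of z] assms
    crosses_in[OF assms(1)] lift_in_R by (auto simp: D_def)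

lemma crossings_D:
  "crossings D = {(Re z, Im z) |i j z. crosses i j \<and> (z = upper i j \<or> z = lower i j)}"
proof (intro equalityI subsetI)
  fix p assume "p \<in> crossings D"
  then obtain x y where xy: "x \<in> D" "y \<in> D" "x \<noteq> y \<and> plane_proj x = plane_proj y" "p = plane_proj x"
    by (auto simp: crossings_def)
  then show "p \<in> {(Re z, Im z) |i j z. crosses i j \<and> (z = upper i j \<or> z = lower i j)}"
    using two_strands_iff[OF xy(1,2)] plane_proj_lift by blast
next
  fix p assume "p \<in> {(Re z, Im z) |i j z. crosses i j \<and> (z = upper i j \<or> z = lower i j)}"
  then obtain i j z where z: "crosses i j" "z = upper i j \<or> z = lower i j" "p = (Re z, Im z)" by auto
  then show "p \<in> crossings D"
    using two_strands_iff[OF crossing_points_in_D[OF z(1,2)]] crossing_points_in_D[OF z(1,2)]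
      plane_proj_lift unfolding crossings_def by blast
qed

lemma finite_crosses: "finite {(i, j). crosses i j}"
  by (rule finite_subset[of _ "I \<times> I"]) (auto simp: crosses_in finite_I)

lemma crossing_point_on_edges:
  assumes "crosses i j" "z = upper i j \<or> z = lower i j"
  shows "Re z \<in> {a i, b i} \<and> a i < Im z \<and> Im z < b i \<or> Im z \<in> {a i, b i} \<and> a i < Re z \<and> Re z < b i"
    and "Re z \<in> {a i, b i, a j, b j}" "Im z \<in> {a i, b i, a j, b j}"
  using assms by (auto simp: crosses_def interleaved_def upper_def lower_def max_def min_def)

text \<open>Every point of a square has an end point of its interval as a coordinate. At a crossing of
\<open>i\<close> and \<open>j\<close> both coordinates are end points for \<open>i\<close> or \<open>j\<close>, so no third square passes through it.\<close>

lemma fibre_at_crossing: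
  assumes ij: "crosses i j" and z: "z = upper i j \<or> z = lower i j"
  shows "{x\<in>D. plane_proj x = (Re z, Im z)} = {lift (s i) z, lift (s j) z}"
proof (intro equalityI subsetI)
  fix x assume "x \<in> {x\<in>D. plane_proj x = (Re z, Im z)}"
  then obtain k w where "k \<in> I" "w \<in> square (a k) (b k)" "x = lift (s k) w"
    and w: "plane_proj (lift (s k) w) = (Re z, Im z)"
    by (auto simp: D_def R_def ring_def)
  moreover from w have "w = z" by (simp add: plane_proj_lift complex_eq_iff)
  moreover have "k = i \<or> k = j"
  proof (rule ccontr)
    assume "\<not> (k = i \<or> k = j)"
    then have "{a k, b k} \<inter> {a i, b i, a j, b j} = {}"
      using ends_distinct[of k i] ends_distinct[of i k] ends_distinct[of k j] ends_distinct[of j k]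
        \<open>k \<in> I\<close> crosses_in[OF ij] by auto
    moreover have "Re z \<in> {a k, b k} \<or> Im z \<in> {a k, b k}"
      using \<open>w \<in> square (a k) (b k)\<close> \<open>w = z\<close> by (simp add: square_def)
    ultimately show False
      using crossing_point_on_edges(2,3)[OF ij z] by blast
  qed
  ultimately show "x \<in> {lift (s i) z, lift (s j) z}" by auto
qed (use crossing_points_in_D[OF ij z] plane_proj_lift in auto)

lemma regular_diagram_D: "regular_diagram D"
  unfolding regular_diagram_def
proof (intro conjI ballI impI polygonal_link_D)
  have "crossings D \<subseteq> (\<Union>(i, j) \<in> {(i, j). crosses i j}.
      {(Re (upper i j), Im (upper i j)), (Re (lower i j), Im (lower i j))})"
    unfolding crossings_D by auto
  then show "finite (crossings D)" 
    by (rule finite_subset) (use finite_crosses in auto)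
next
  fix p assume "p \<in> crossings D"
  then obtain i j z where z: "crosses i j" "z = upper i j \<or> z = lower i j" "p = (Re z, Im z)"
    by (auto simp: crossings_D)
  have "lift (s i) z \<noteq> lift (s j) z"
    using two_strands_iff[OF crossing_points_in_D[OF z(1,2)]] z by blast
  then show "card {x\<in>D. plane_proj x = p} = 2"
    using fibre_at_crossing[OF z(1,2)] z(3) by simp
next
  fix x assume "x \<in> D" "plane_proj x \<in> crossings D"
  then obtain i j z where z: "crosses i j" "z = upper i j \<or> z = lower i j"
    "x \<in> D" "plane_proj x = (Re z, Im z)"
    by (auto simp: crossings_D)
  then have "x = lift (s i) z \<or> x = lift (s j) z" using fibre_at_crossing by auto
  then obtain i j where z: "crosses i j" "z = upper i j \<or> z = lower i j" "x = lift (s i) z"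
    using z crosses_sym upper_sym lower_sym by metis
  have i: "i \<in> I" using crosses_in z by auto
  have "x \<in> R i"
    using in_two_squares_iff[OF crosses_in[OF z(1)] crosses_neq[OF z(1)], of z] z lift_in_R by auto
  then show "locally_straight_at D x"
    using ring_locally_straight[OF crossing_point_on_edges(1)[OF z(1,2)] closed_others[of i], of "s i"]
      R_Int_others[OF i] D_eq[OF i] z(3) by (auto simp: R_def)
qed

lemma lies_below_iff:
  assumes "x \<in> D" "y \<in> D"
  shows "lies_below x y \<longleftrightarrow> (\<exists>i j z. crosses i j \<and> x = lift (s i) z \<and> y = lift (s j) z \<and>
    (z = upper i j \<and> s i < s j \<or> z = lower i j \<and> s j < s i))"
proof -
  have "lies_below x y \<longleftrightarrow> x $ 3 < y $ 3 \<and> x \<noteq> y \<and> plane_proj x = plane_proj y"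
    by (auto simp: lies_below_def)
  also have "\<dots> \<longleftrightarrow> (\<exists>i j z. x $ 3 < y $ 3 \<and> crosses i j \<and> (z = upper i j \<or> z = lower i j) \<and>
      x = lift (s i) z \<and> y = lift (s j) z)"
    unfolding two_strands_iff[OF assms] by blast
  also have "\<dots> \<longleftrightarrow> (\<exists>i j z. crosses i j \<and> x = lift (s i) z \<and> y = lift (s j) z \<and>
    (z = upper i j \<and> s i < s j \<or> z = lower i j \<and> s j < s i))"
  proof -
    have "s i * (Im z - Re z) < s j * (Im z - Re z) \<longleftrightarrow>
        z = upper i j \<and> s i < s j \<or> z = lower i j \<and> s j < s i"
      if "crosses i j" "z = upper i j \<or> z = lower i j" for i j z
      using crosses_upper_less[OF that(1)] crosses_lower_less[OF that(1)] that(2)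
      by (auto simp: mult_less_cancel_right)
    then have higher: "x $ 3 < y $ 3 \<longleftrightarrow> z = upper i j \<and> s i < s j \<or> z = lower i j \<and> s j < s i"
      if "crosses i j" "z = upper i j \<or> z = lower i j" "x = lift (s i) z" "y = lift (s j) z" for i j z
      using that by (simp only: lift_nth)
    show ?thesis
      by (intro iff_exI) (use higher in blast)
  qed
  finally show ?thesis .
qed

text \<open>Each crossing is determined by the pair (upper ring, lower ring), since the two crossings of the same two
rings have opposite roles.\<close>

lemma crossings_le_linked_pairs: "card (crossings D) \<le> card (linked_pairs D)"
proof -
  let ?C = "{(i, j). crosses i j}"
  \<comment> \<open>the crossing at which ring j passes above ring i\<close>
  define pt where "pt = (\<lambda>(i, j). if s i < s j then upper i j else lower i j)"
  have "crossings D \<subseteq> (\<lambda>P. (Re (pt P), Im (pt P))) ` ?C"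
  proof
    fix p assume "p \<in> crossings D"
    then obtain i j z where z: "crosses i j" "z = upper i j \<or> z = lower i j" "p = (Re z, Im z)"
      by (auto simp: crossings_D)
    have "s i < s j \<or> s j < s i" using crosses_slopes[OF z(1)] by linarith
    then have "z = pt (i, j) \<or> z = pt (j, i)"
      using z(2) upper_sym[of i j] lower_sym[of i j] by (auto simp: pt_def)
    then show "p \<in> (\<lambda>P. (Re (pt P), Im (pt P))) ` ?C"
      using z(1,3) crosses_sym[OF z(1)] by auto
  qed
  then have "card (crossings D) \<le> card ?C"
    using surj_card_le finite_crosses by blast
  also have "\<dots> \<le> card (linked_pairs D)"
  proof (rule card_inj_on_le)
    show "inj_on (map_prod R R) ?C"
      using inj_on_R crosses_in by (auto simp: inj_on_def)
    show "map_prod R R ` ?C \<subseteq> linked_pairs D"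
    proof (rule image_subsetI)
      fix P assume "P \<in> ?C"
      then obtain i j where P: "P = (i, j)" "crosses i j" by auto
      have "\<not> shrinks_in (R i) (- R j)"
        using interleaved_rings_linked crosses_slopes P by (auto simp: R_def crosses_def)
      moreover have "R i \<noteq> R j"
        using inj_on_R P crosses_in crosses_neq by (auto simp: inj_on_eq_iff)
      ultimately show "map_prod R R P \<in> linked_pairs D"
        using P crosses_in by (auto simp: linked_pairs_def components_D)
    qed
    show "finite (linked_pairs D)"
      by (rule finite_subset[of _ "components D \<times> components D"])
        (auto simp: linked_pairs_def components_D finite_I)
  qed
  finally show ?thesis .
qed

lemma minimal_diagram_D: "minimal_diagram_of D D"
  using minimal_diagram_if_crossings_le_linked_pairs regular_diagram_D crossings_le_linked_pairs by auto

text \<open>Every ring lies on one side of a splitting sphere, and crossing rings lie on the same side because they are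
linked. So the rings inside form a set that is closed under crossing.\<close>

lemma not_splittable_D:
  assumes conn: "\<And>J. J \<subseteq> I \<Longrightarrow> J \<noteq> {} \<Longrightarrow> (\<And>i j. i \<in> J \<Longrightarrow> crosses i j \<Longrightarrow> j \<in> J) \<Longrightarrow> J = I"
  shows "\<not> splittable D"
proof
  assume "splittable D"
  then obtain S where S: "ambient_isotopic (sphere 0 1) S" "S \<inter> D = {}"
    "inside S \<inter> D \<noteq> {}" "outside S \<inter> D \<noteq> {}"
    by (auto simp: splittable_def)
  obtain H K where H: "homeomorphism UNIV UNIV H K" "H ` sphere (0::real^3) 1 = S"
    using S(1) by (rule ambient_isotopic_homeomorphism)
  have "compact S"
    using H compact_continuous_image[OF continuous_on_subset compact_sphere]
    by (metis homeomorphism_def subset_UNIV)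
  then have op: "open (inside S)" "open (outside S)"
    by (auto intro: open_inside open_outside compact_imp_closed)
  have side: "R i \<subseteq> inside S \<or> R i \<subseteq> outside S" if "i \<in> I" for i
  proof -
    have "R i \<subseteq> - S" using S(2) that by (auto simp: D_def)
    then have "R i \<subseteq> inside S \<union> outside S" by simp
    moreover from this have "inside S \<inter> R i = {} \<or> outside S \<inter> R i = {}"
      by (intro connectedD[OF R_connected[OF that] op]) auto
    ultimately show ?thesis by blast
  qed
  define J where "J = {i\<in>I. R i \<subseteq> inside S}"
  have "J = I"
  proof (rule conn)
    obtain x i where "x \<in> inside S" "i \<in> I" "x \<in> R i" using S(3) by (auto simp: D_def)
    then have "i \<in> J" using side[of i] inside_Int_outside[of S] unfolding J_def by blast
    then show "J \<noteq> {}" by auto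
    fix i j assume i: "i \<in> J" and ij: "crosses i j"
    have "\<not> R j \<subseteq> outside S"
    proof
      assume "R j \<subseteq> outside S"
      then have "shrinks_in (R i) (- R j)"
        using shrinks_in_if_separated_by_sphere[OF S(1)] i by (auto simp: J_def)
      then show False
        using interleaved_rings_linked crosses_slopes[OF ij] ij by (auto simp: R_def crosses_def)
    qed
    then show "j \<in> J" using side[of j] crosses_in[OF ij] by (auto simp: J_def)
  qed (auto simp: J_def)
  then have "D \<subseteq> inside S" by (auto simp: J_def D_def)
  then show False using S(4) inside_Int_outside[of S] by blast
qed

end


section \<open>Arcs and colorings of a cycle of square rings\<close>

text \<open>Closed curves are parametrized by \<open>[0, 4]\<close> to match \<open>perimeter\<close>. Two points \<open>c u\<close> and \<open>c v\<close> cut the curve into the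
open arc between them and the open arc through the base point \<open>c 0 = c 4\<close>.\<close>

locale simple_loop =
  fixes c :: "real \<Rightarrow> 'a::euclidean_space"
  assumes cont: "continuous_on {0..4} c" and inj: "inj_on c {0..<4}" and closed_up: "c 0 = c 4"
begin

definition inner_arc :: "real \<Rightarrow> real \<Rightarrow> 'a set" where
  "inner_arc u v = c ` {u<..<v}"

definition outer_arc :: "real \<Rightarrow> real \<Rightarrow> 'a set" where
  "outer_arc u v = c ` ({0..<u} \<union> {v<..4})"

lemma eq_iff:
  assumes "t \<in> {0..4}" "u \<in> {0..4}"
  shows "c t = c u \<longleftrightarrow> t = u \<or> t = 0 \<and> u = 4 \<or> t = 4 \<and> u = 0"
proof -
  define n where "n x = (if x = 4 then 0 else x)" for x :: real
  have n: "c (n x) = c x" "x \<in> {0..4} \<Longrightarrow> n x \<in> {0..<4}" for x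
    using closed_up by (auto simp: n_def)
  have "c t = c u \<longleftrightarrow> n t = n u"
    using inj_on_eq_iff[OF inj n(2)[OF assms(1)] n(2)[OF assms(2)]] n(1) by simp
  also have "\<dots> \<longleftrightarrow> t = u \<or> t = 0 \<and> u = 4 \<or> t = 4 \<and> u = 0"
    by (auto simp: n_def)
  finally show ?thesis .
qed

context
  fixes u v :: real
  assumes uv: "0 < u" "u < v" "v < 4"
begin

lemma in_inner_arc_iff: "t \<in> {0..4} \<Longrightarrow> c t \<in> inner_arc u v \<longleftrightarrow> u < t \<and> t < v"
  using uv eq_iff by (fastforce simp: inner_arc_def)

lemma in_outer_arc_iff: "t \<in> {0..4} \<Longrightarrow> c t \<in> outer_arc u v \<longleftrightarrow> t < u \<or> v < t"
  using uv eq_iff by (fastforce simp: outer_arc_def)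

lemma arcs_subset: "inner_arc u v \<subseteq> c ` {0..4}" "outer_arc u v \<subseteq> c ` {0..4}"
  using uv by (auto simp: inner_arc_def outer_arc_def)

lemma arcs_disjoint: "inner_arc u v \<inter> outer_arc u v = {}"
proof (rule ccontr)
  assume "inner_arc u v \<inter> outer_arc u v \<noteq> {}"
  then obtain x where x: "x \<in> inner_arc u v" "x \<in> outer_arc u v" by blast
  then obtain t where "t \<in> {0..4}" "x = c t" using arcs_subset by blast
  then show False using x in_inner_arc_iff in_outer_arc_iff by auto
qed

lemma arcs_Un: "inner_arc u v \<union> outer_arc u v = c ` {0..4} - {c u, c v}"
proof (intro equalityI subsetI)
  fix x assume x: "x \<in> inner_arc u v \<union> outer_arc u v"
  then obtain t where "t \<in> {0..4}" "x = c t" using arcs_subset by blast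
  then show "x \<in> c ` {0..4} - {c u, c v}"
    using x in_inner_arc_iff in_outer_arc_iff eq_iff uv by auto
next
  fix x assume "x \<in> c ` {0..4} - {c u, c v}"
  then obtain t where "t \<in> {0..4}" "x = c t" "t \<noteq> u" "t \<noteq> v" by blast
  then show "x \<in> inner_arc u v \<union> outer_arc u v"
    using in_inner_arc_iff in_outer_arc_iff by auto
qed

lemma arcs_nonempty: "inner_arc u v \<noteq> {}" "outer_arc u v \<noteq> {}"
  using uv by (auto simp: inner_arc_def outer_arc_def)

lemma arcs_connected: "connected (inner_arc u v)" "connected (outer_arc u v)"
proof -
  have conn: "connected (c ` S)" if "connected S" "S \<subseteq> {0..4}" for S
    using that cont continuous_on_subset connected_continuous_image by blast
  show "connected (inner_arc u v)"
    unfolding inner_arc_def using uv by (intro conn) auto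
  have "connected (c ` {0..<u} \<union> c ` {v<..4})"
  proof (rule connected_Un)
    show "c ` {0..<u} \<inter> c ` {v<..4} \<noteq> {}"
      using uv closed_up by (auto intro!: image_eqI[of _ c 4] simp: disjoint_iff)
  qed (use uv in \<open>auto intro!: conn\<close>)
  then show "connected (outer_arc u v)" by (simp add: outer_arc_def image_Un)
qed

lemma closed_image: "S \<subseteq> {0..4} \<Longrightarrow> closed S \<Longrightarrow> closed (c ` S)"
  using cont by (meson bounded_subset bounded_closed_interval compact_continuous_image
      compact_eq_bounded_closed compact_imp_closed continuous_on_subset bounded_cbox)

text \<open>This form and the next one show that the arcs are open in the curve: each is the curve minus the
compact image of the complementary closed parameters.\<close>

lemma inner_arc_eq: "inner_arc u v = c ` {0..4} - c ` ({0..u} \<union> {v..4})"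
proof (intro equalityI subsetI DiffI notI)
  fix x assume x: "x \<in> inner_arc u v"
  then obtain t where t: "t \<in> {0..4}" "x = c t" using arcs_subset by blast
  then show "x \<in> c ` {0..4}" by simp
  assume "x \<in> c ` ({0..u} \<union> {v..4})"
  then obtain w where w: "w \<in> ({0..u} \<union> {v..4})" "c w = c t" using t(2) by (metis imageE)
  then have "w \<in> {0..4}" using uv by auto
  then show False
    using x t w uv eq_iff[of w t] in_inner_arc_iff[OF t(1)] by auto
next
  fix x assume "x \<in> c ` {0..4} - c ` ({0..u} \<union> {v..4})"
  then obtain t where t: "t \<in> {0..4}" "x = c t" "t \<notin> ({0..u} \<union> {v..4})" by blast
  then show "x \<in> inner_arc u v" using in_inner_arc_iff[OF t(1)] by auto
qed

lemma outer_arc_eq: "outer_arc u v = c ` {0..4} - c ` {u..v}"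
proof (intro equalityI subsetI DiffI notI)
  fix x assume x: "x \<in> outer_arc u v"
  then obtain t where t: "t \<in> {0..4}" "x = c t" using arcs_subset by blast
  then show "x \<in> c ` {0..4}" by simp
  assume "x \<in> c ` {u..v}"
  then obtain w where w: "w \<in> {u..v}" "c w = c t" using t(2) by (metis imageE)
  then have "w \<in> {0..4}" using uv by auto
  then show False
    using x t w uv eq_iff[of w t] in_outer_arc_iff[OF t(1)] by auto
next
  fix x assume "x \<in> c ` {0..4} - c ` {u..v}"
  then obtain t where t: "t \<in> {0..4}" "x = c t" "t \<notin> {u..v}" by blast
  then show "x \<in> outer_arc u v" using in_outer_arc_iff[OF t(1)] by auto
qed

lemma closure_arcs_subset: "closure (inner_arc u v) \<subseteq> c ` {0..4}" "closure (outer_arc u v) \<subseteq> c ` {0..4}"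
  using arcs_subset closed_image[of "{0..4}"] by (simp_all add: closure_minimal)

lemma closure_image_subset: "S \<subseteq> {0..4} \<Longrightarrow> c ` closure S \<subseteq> closure (c ` S)"
proof (rule image_closure_subset)
  assume S: "S \<subseteq> {0..4}"
  then show "continuous_on (closure S) c"
    using closure_minimal[OF S] continuous_on_subset[OF cont] by simp
qed (auto simp: closure_subset)

lemma ends_in_closure_arcs:
  "c u \<in> closure (inner_arc u v)" "c v \<in> closure (inner_arc u v)"
  "c u \<in> closure (outer_arc u v)" "c v \<in> closure (outer_arc u v)"
proof -
  have "c ` {u..v} \<subseteq> closure (inner_arc u v)"
    using closure_image_subset[of "{u<..<v}"] uv by (simp add: inner_arc_def subset_eq)
  then show "c u \<in> closure (inner_arc u v)" "c v \<in> closure (inner_arc u v)"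
    using uv by auto
  have "c ` {0..u} \<subseteq> closure (c ` {0..<u})" "c ` {v..4} \<subseteq> closure (c ` {v<..4})"
    using closure_image_subset[of "{0..<u}"] closure_image_subset[of "{v<..4}"] uv
    by (simp_all add: subset_eq)
  then have "c ` {0..u} \<subseteq> closure (outer_arc u v)" "c ` {v..4} \<subseteq> closure (outer_arc u v)"
    by (simp_all add: outer_arc_def image_Un closure_Un le_supI1 le_supI2)
  then show "c u \<in> closure (outer_arc u v)" "c v \<in> closure (outer_arc u v)"
    using uv by auto
qed

end

end

text \<open>With exactly two neighbors, a ring has two under points, and its diagram arcs are the two arcs
between them.\<close>

locale square_cycle = square_system +
  assumes two_neighbours: "\<And>i. i \<in> I \<Longrightarrow> \<exists>p q. p \<noteq> q \<and> {j. crosses i j} = {p, q}"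
begin

definition c :: "'a \<Rightarrow> real \<Rightarrow> real^3" where
  "c i t = lift (s i) (perimeter (a i) (b i) t)"

text \<open>The time at which ring \<open>i\<close> passes through its upper crossing with \<open>j\<close>; it passes through the lower one at time
\<open>4 - \<tau> i j\<close>. So the under point and the over point of \<open>i\<close> at its crossings with \<open>j\<close> are always mirror images,
and which is which depends on the slopes.\<close>

definition \<tau> :: "'a \<Rightarrow> 'a \<Rightarrow> real" where
  "\<tau> i j = (SOME t. 0 < t \<and> t < 2 \<and> perimeter (a i) (b i) t = upper i j)"

definition under_at :: "'a \<Rightarrow> 'a \<Rightarrow> real" where
  "under_at i j = (if s i < s j then \<tau> i j else 4 - \<tau> i j)"

definition over_at :: "'a \<Rightarrow> 'a \<Rightarrow> real" where
  "over_at i j = 4 - under_at i j"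

lemma c_image: "i \<in> I \<Longrightarrow> c i ` {0..4} = R i"
  unfolding c_def R_def ring_def perimeter_image[OF a_less_b, symmetric] by (simp add: image_image)

lemma simple_loop_c: "i \<in> I \<Longrightarrow> simple_loop (c i)"
proof
  assume i: "i \<in> I"
  show "continuous_on {0..4} (c i)" unfolding c_def
    by (rule continuous_on_compose2[OF continuous_on_lift[of UNIV] continuous_on_perimeter]) auto
  show "inj_on (c i) {0..<4}"
    using perimeter_inj[OF a_less_b[OF i]] by (auto simp: inj_on_def c_def)
  show "c i 0 = c i 4" by (simp add: c_def perimeter_ends)
qed

lemma \<tau>:
  assumes "crosses i j"
  shows "0 < \<tau> i j" "\<tau> i j < 2" "c i (\<tau> i j) = lift (s i) (upper i j)"
    "c i (4 - \<tau> i j) = lift (s i) (lower i j)"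
proof -
  have "upper i j \<in> square (a i) (b i)"
    using in_two_squares_iff[OF crosses_in[OF assms] crosses_neq[OF assms]] assms by auto
  then have "\<exists>t. 0 < t \<and> t < 2 \<and> perimeter (a i) (b i) t = upper i j"
    using square_upper_param[OF a_less_b] crosses_in[OF assms] crosses_upper_less[OF assms] by metis
  then have *: "0 < \<tau> i j \<and> \<tau> i j < 2 \<and> perimeter (a i) (b i) (\<tau> i j) = upper i j"
    unfolding \<tau>_def by (rule someI_ex)
  then show "0 < \<tau> i j" "\<tau> i j < 2" "c i (\<tau> i j) = lift (s i) (upper i j)"
    "c i (4 - \<tau> i j) = lift (s i) (lower i j)"
    by (auto simp: c_def perimeter_mirror upper_def lower_def)
qed

lemma \<tau>_neq:
  assumes "crosses i j" "crosses i k" "j \<noteq> k"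
  shows "\<tau> i j \<noteq> \<tau> i k"
proof
  assume "\<tau> i j = \<tau> i k"
  then have eq: "upper i j = upper i k" using \<tau>(3)[OF assms(1)] \<tau>(3)[OF assms(2)] by simp
  have z: "lift (s l) (upper i l) \<in> R l" "lift (s i) (upper i l) \<in> R i" if "crosses i l" for l
    using in_two_squares_iff[OF crosses_in[OF that] crosses_neq[OF that]] that by (auto intro: lift_in_R)
  have "lift (s k) (upper i k) \<in> {lift (s i) (upper i j), lift (s j) (upper i j)}"
    using fibre_at_crossing[OF assms(1), of "upper i j"] eq plane_proj_lift
      crossing_points_in_D(2)[OF assms(2), of "upper i k"] by auto
  then show False
    using z[OF assms(1)] z[OF assms(2)] eq assms(3)
      R_disjoint[of j k] R_disjoint[of i k] crosses_in crosses_neq assms by (metis disjoint_iff insertE singletonD)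
qed

lemma under_at_bounds:
  assumes "crosses i j"
  shows "0 < under_at i j" "under_at i j < 4"
  using \<tau>(1,2)[OF assms] by (auto simp: under_at_def)

lemma under_at_neq:
  assumes "crosses i j" "crosses i k" "j \<noteq> k"
  shows "under_at i j \<noteq> under_at i k"
  using \<tau>(1,2)[OF assms(1)] \<tau>(1,2)[OF assms(2)] \<tau>_neq[OF assms] by (auto simp: under_at_def)

lemma over_at_neq_under_at:
  assumes "crosses i j" "crosses i k"
  shows "over_at i j \<noteq> under_at i k"
  using \<tau>(1,2)[OF assms(1)] \<tau>(1,2)[OF assms(2)] \<tau>_neq[OF assms]
  by (cases "j = k") (auto simp: under_at_def over_at_def)

lemma lies_below_iff_under_over:
  assumes "x \<in> D" "y \<in> D"
  shows "lies_below x y \<longleftrightarrow> (\<exists>i j. crosses i j \<and> x = c i (under_at i j) \<and> y = c j (over_at j i))"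
proof -
  have "(\<exists>z. x = lift (s i) z \<and> y = lift (s j) z \<and>
      (z = upper i j \<and> s i < s j \<or> z = lower i j \<and> s j < s i)) \<longleftrightarrow>
     x = c i (under_at i j) \<and> y = c j (over_at j i)" if ij: "crosses i j" for i j
  proof -
    have "s i < s j \<or> s j < s i" using crosses_slopes[OF ij] by linarith
    then show ?thesis
      using \<tau>(3,4)[OF ij] \<tau>(3,4)[OF crosses_sym[OF ij]] upper_sym[of i j] lower_sym[of i j]
      by (auto simp: under_at_def over_at_def)
  qed
  then show ?thesis unfolding lies_below_iff[OF assms] by blast
qed

text \<open>\<open>lo i\<close> and \<open>hi i\<close> are the times of the two under points of ring \<open>i\<close>. As a minimum and a maximum they do not depend on
an order of the two neighbors.\<close>

definition lo :: "'a \<Rightarrow> real" where "lo i = Min (under_at i ` {j. crosses i j})"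
definition hi :: "'a \<Rightarrow> real" where "hi i = Max (under_at i ` {j. crosses i j})"

lemma two_neighboursE:
  assumes "i \<in> I"
  obtains p q where "p \<noteq> q" "crosses i p" "crosses i q" "\<And>j. crosses i j \<Longrightarrow> j = p \<or> j = q"
    "lo i = min (under_at i p) (under_at i q)" "hi i = max (under_at i p) (under_at i q)"
proof -
  obtain p q where pq: "p \<noteq> q" "{j. crosses i j} = {p, q}" using two_neighbours[OF assms] by auto
  then have "lo i = min (under_at i p) (under_at i q)" "hi i = max (under_at i p) (under_at i q)"
    by (auto simp: lo_def hi_def)
  then show ?thesis using that[of p q] pq by blast
qed

lemma lo_hi: 
  assumes "i \<in> I"
  shows "0 < lo i" "lo i < hi i" "hi i < 4"
  using assms
proof -
  obtain p q where pq: "p \<noteq> q" "crosses i p" "crosses i q"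
    "lo i = min (under_at i p) (under_at i q)" "hi i = max (under_at i p) (under_at i q)"
    using two_neighboursE[OF assms] by metis
  then show "0 < lo i" "lo i < hi i" "hi i < 4"
    using under_at_bounds under_at_neq[OF pq(2,3,1)] by auto
qed

lemma lo_hi_under: "i \<in> I \<Longrightarrow> {lo i, hi i} = under_at i ` {j. crosses i j}"
  by (erule two_neighboursE) (auto simp: min_def max_def)

definition In :: "'a \<Rightarrow> (real^3) set" where "In i = simple_loop.inner_arc (c i) (lo i) (hi i)"
definition Out :: "'a \<Rightarrow> (real^3) set" where "Out i = simple_loop.outer_arc (c i) (lo i) (hi i)"

lemma In_Out: 
  assumes "i \<in> I"
  shows "In i \<noteq> {}" "Out i \<noteq> {}" "connected (In i)" "connected (Out i)" "In i \<inter> Out i = {}"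
    "In i \<union> Out i = R i - {c i (lo i), c i (hi i)}" "closure (In i) \<subseteq> R i" "closure (Out i) \<subseteq> R i"
    "\<And>t. t \<in> {0..4} \<Longrightarrow> c i t \<in> In i \<longleftrightarrow> lo i < t \<and> t < hi i"
    "\<And>t. t \<in> {0..4} \<Longrightarrow> c i t \<in> Out i \<longleftrightarrow> t < lo i \<or> hi i < t"
    "t \<in> {lo i, hi i} \<Longrightarrow> c i t \<in> closure (In i) \<and> c i t \<in> closure (Out i)"
    "\<exists>X. closed X \<and> In i = R i - X" "\<exists>X. closed X \<and> Out i = R i - X"
proof -
  interpret simple_loop "c i" by (rule simple_loop_c[OF assms])
  note lh = lo_hi[OF assms]
  show "In i \<noteq> {}" "Out i \<noteq> {}" "connected (In i)" "connected (Out i)" "In i \<inter> Out i = {}"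
    "In i \<union> Out i = R i - {c i (lo i), c i (hi i)}" "closure (In i) \<subseteq> R i" "closure (Out i) \<subseteq> R i"
    "\<And>t. t \<in> {0..4} \<Longrightarrow> c i t \<in> In i \<longleftrightarrow> lo i < t \<and> t < hi i"
    "\<And>t. t \<in> {0..4} \<Longrightarrow> c i t \<in> Out i \<longleftrightarrow> t < lo i \<or> hi i < t"
    "t \<in> {lo i, hi i} \<Longrightarrow> c i t \<in> closure (In i) \<and> c i t \<in> closure (Out i)"
    unfolding In_def Out_def
    using arcs_nonempty[OF lh] arcs_connected[OF lh] arcs_disjoint[OF lh] arcs_Un[OF lh]
      closure_arcs_subset[OF lh] in_inner_arc_iff[OF lh] in_outer_arc_iff[OF lh]
      ends_in_closure_arcs[OF lh] c_image[OF assms] by auto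
  show "\<exists>X. closed X \<and> In i = R i - X" "\<exists>X. closed X \<and> Out i = R i - X"
    unfolding In_def Out_def inner_arc_eq[OF lh] outer_arc_eq[OF lh] c_image[OF assms]
    using closed_image[OF lh, of "{0..lo i} \<union> {hi i..4}"] closed_image[OF lh, of "{lo i..hi i}"] lh by auto
qed

lemma under_points_D: "under_points D = (\<Union>i\<in>I. {c i (lo i), c i (hi i)})"
proof -
  have "under_points D = {c i (under_at i j) |i j. crosses i j}"
  proof (intro equalityI subsetI)
    fix x assume "x \<in> under_points D"
    then obtain y where "x \<in> D" "y \<in> D" "lies_below x y" by (auto simp: under_points_def)
    then show "x \<in> {c i (under_at i j) |i j. crosses i j}"
      using lies_below_iff_under_over by blast
  next
    fix x assume "x \<in> {c i (under_at i j) |i j. crosses i j}"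
    then obtain i j where ij: "crosses i j" and x: "x = c i (under_at i j)" by auto
    have "x \<in> R i" "c j (over_at j i) \<in> R j"
      using under_at_bounds[OF ij] under_at_bounds[OF crosses_sym[OF ij]]
        c_image[OF crosses_in(1)[OF ij]] c_image[OF crosses_in(2)[OF ij]]
      by (auto simp: x over_at_def)
    then have "x \<in> D" "c j (over_at j i) \<in> D" using crosses_in[OF ij] by (auto simp: D_def)
    then show "x \<in> under_points D"
      using lies_below_iff_under_over[of x "c j (over_at j i)"] ij x unfolding under_points_def by blast
  qed
  also have "\<dots> = (\<Union>i\<in>I. c i ` under_at i ` {j. crosses i j})"
    using crosses_in(1) by auto
  also have "\<dots> = (\<Union>i\<in>I. {c i (lo i), c i (hi i)})"
  proof (rule SUP_cong)
    fix i assume "i \<in> I"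
    then show "c i ` under_at i ` {j. crosses i j} = {c i (lo i), c i (hi i)}"
      using lo_hi_under[of i] by (metis image_insert image_empty)
  qed simp
  finally show ?thesis .
qed

lemma D_minus_under_points: "D - under_points D = (\<Union>i\<in>I. In i \<union> Out i)"
proof -
  have "R i - under_points D = In i \<union> Out i" if i: "i \<in> I" for i
  proof -
    have "c j t \<notin> R i" if "j \<in> I" "j \<noteq> i" "t \<in> {0..4}" for j t
      using c_image[OF that(1)] R_disjoint[OF that(1) i that(2)] that(3) by auto
    then have "c j (lo j) \<notin> R i" "c j (hi j) \<notin> R i" if "j \<in> I" "j \<noteq> i" for j
      using that lo_hi[OF that(1)] by auto
    then have "R i - under_points D = R i - {c i (lo i), c i (hi i)}"
      using i by (auto simp: under_points_D)
    then show ?thesis using In_Out(6)[OF i] by simp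
  qed
  then show ?thesis unfolding D_def by blast
qed

lemma arc_subset_R: "i \<in> I \<Longrightarrow> In i \<subseteq> R i" "i \<in> I \<Longrightarrow> Out i \<subseteq> R i"
  using In_Out(6) by auto

lemma diagram_arcs_D: "diagram_arcs D = In ` I \<union> Out ` I"
  unfolding diagram_arcs_def D_minus_under_points
proof (rule components_eq_if_open_partition)
  let ?M = "\<Union>i\<in>I. In i \<union> Out i"
  have op: "openin (top_of_set ?M) C" if i: "i \<in> I" and C: "C \<subseteq> ?M" "closed X" "C = R i - X" for i C X
  proof -
    have "?M \<subseteq> R i \<union> (\<Union>j\<in>I - {i}. R j)" using arc_subset_R by blast
    moreover note R_Int_others[OF i]
    ultimately have "C = ?M \<inter> - (X \<union> (\<Union>j\<in>I - {i}. R j))"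
      using C by blast
    moreover have "open (- (X \<union> (\<Union>j\<in>I - {i}. R j)))"
      using C(2) closed_others[of i] by blast
    ultimately show ?thesis unfolding openin_open by blast
  qed
  fix C assume "C \<in> In ` I \<union> Out ` I"
  then show "openin (top_of_set ?M) C" "connected C" "C \<noteq> {}"
    using In_Out(1-4,12,13) op by blast+
next
  fix C C' assume CC: "C \<in> In ` I \<union> Out ` I" "C' \<in> In ` I \<union> Out ` I" "C \<noteq> C'"
  then obtain i j where ij: "i \<in> I" "j \<in> I" "C = In i \<or> C = Out i" "C' = In j \<or> C' = Out j" by auto
  then show "C \<inter> C' = {}"
    using R_disjoint[of i j] arc_subset_R[of i] arc_subset_R[of j] In_Out(5)[of i] CC(3)
    by (cases "i = j") blast+
qed auto

lemma In_neq_Out: "i \<in> I \<Longrightarrow> j \<in> I \<Longrightarrow> In i \<noteq> Out j"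
  using R_disjoint[of i j] arc_subset_R(1)[of i] arc_subset_R(2)[of j] In_Out(1,5)[of i]
  by (cases "i = j") fastforce+

lemma In_eq_iff: "i \<in> I \<Longrightarrow> j \<in> I \<Longrightarrow> In i = In j \<longleftrightarrow> i = j"
  using R_disjoint[of i j] arc_subset_R(1)[of i] arc_subset_R(1)[of j] In_Out(1)[of i]
  by (cases "i = j") auto

lemma Out_eq_iff: "i \<in> I \<Longrightarrow> j \<in> I \<Longrightarrow> Out i = Out j \<longleftrightarrow> i = j"
  using R_disjoint[of i j] arc_subset_R(2)[of i] arc_subset_R(2)[of j] In_Out(2)[of i]
  by (cases "i = j") auto

text \<open>The arc of ring \<open>i\<close> that contains its point at time \<open>t\<close>, if that is not an under point.\<close>

definition side :: "'a \<Rightarrow> real \<Rightarrow> (real^3) set" where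
  "side i t = (if lo i < t \<and> t < hi i then In i else Out i)"

lemma over_point_in_side:
  assumes "crosses i j"
  shows "c i (over_at i j) \<in> side i (over_at i j)"
proof -
  have i: "i \<in> I" using crosses_in assms by auto
  have "over_at i j \<in> {0..4}" using under_at_bounds[OF assms] by (auto simp: over_at_def)
  moreover have "over_at i j \<notin> {lo i, hi i}"
    using over_at_neq_under_at[OF assms] lo_hi_under[OF i] by auto
  ultimately show ?thesis using In_Out(9,10)[OF i, of "over_at i j"] by (auto simp: side_def)
qed

lemma side_in_arcs: "i \<in> I \<Longrightarrow> side i t \<in> diagram_arcs D"
  by (auto simp: side_def diagram_arcs_D)

text \<open>Both arcs of a ring end at both of its under points. This is why the coloring condition at an
under point of ring \<open>j\<close> involves the sum over the two arcs of \<open>j\<close>, whichever of the two under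
points it is.\<close>

lemma arcs_at_under_point:
  assumes "crosses i j"
  shows "{u\<in>diagram_arcs D. c i (under_at i j) \<in> closure u} = {In i, Out i}"
proof -
  have i: "i \<in> I" using crosses_in assms by auto
  have t: "under_at i j \<in> {lo i, hi i}" "under_at i j \<in> {0..4}"
    using lo_hi_under[OF i] assms under_at_bounds[OF assms] by auto
  then have "c i (under_at i j) \<in> R i" using c_image[OF i] by auto
  then have "c i (under_at i j) \<notin> closure (In k)" "c i (under_at i j) \<notin> closure (Out k)" if "k \<in> I" "k \<noteq> i" for k
    using In_Out(7,8)[OF that(1)] R_disjoint[OF that(1) i that(2)] by auto
  then show ?thesis
    using In_Out(11)[OF i t(1)] i by (auto simp: diagram_arcs_D)
qed

lemma Z_coloring_D_iff:
  "Z_coloring D \<gamma> \<longleftrightarrow> (\<forall>i j. crosses i j \<longrightarrow> 2 * \<gamma> (side i (over_at i j)) = \<gamma> (In j) + \<gamma> (Out j))"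
proof (intro iffI allI impI)
  fix i j assume col: "Z_coloring D \<gamma>" and ij: "crosses i j"
  let ?x = "c j (under_at j i)" and ?y = "c i (over_at i j)"
  have ji: "crosses j i" by (rule crosses_sym[OF ij])
  have "?x \<in> R j" "?y \<in> R i"
    using c_image[OF crosses_in(1)[OF ij]] c_image[OF crosses_in(2)[OF ij]]
      under_at_bounds[OF ij] under_at_bounds[OF ji] by (auto simp: over_at_def)
  then have xy: "?x \<in> D" "?y \<in> D" using crosses_in[OF ij] by (auto simp: D_def)
  then have "lies_below ?x ?y" using lies_below_iff_under_over[OF xy] ji by auto
  then show "2 * \<gamma> (side i (over_at i j)) = \<gamma> (In j) + \<gamma> (Out j)"
    using col xy over_point_in_side[OF ij] side_in_arcs[OF crosses_in(1)[OF ij]]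
      arcs_at_under_point[OF ji] unfolding Z_coloring_def by blast
next
  assume rel: "\<forall>i j. crosses i j \<longrightarrow> 2 * \<gamma> (side i (over_at i j)) = \<gamma> (In j) + \<gamma> (Out j)"
  show "Z_coloring D \<gamma>"
    unfolding Z_coloring_def
  proof (intro ballI allI impI)
    fix x y A B C
    assume xy: "x \<in> D" "y \<in> D" "lies_below x y" and A: "A \<in> diagram_arcs D"
      and "y \<in> A \<and> {B, C} = {u\<in>diagram_arcs D. x \<in> closure u}"
    then have y: "y \<in> A" and BC: "{B, C} = {u\<in>diagram_arcs D. x \<in> closure u}" by auto
    obtain j i where ji: "crosses j i" and x: "x = c j (under_at j i)" and y': "y = c i (over_at i j)"
      using lies_below_iff_under_over[OF xy(1,2)] xy(3) by auto
    have ij: "crosses i j" by (rule crosses_sym[OF ji])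
    have "A = side i (over_at i j)"
      using A y y' over_point_in_side[OF ij] side_in_arcs[OF crosses_in(1)[OF ij]]
        components_eq[of A "D - under_points D"] unfolding diagram_arcs_def by blast
    moreover have "{B, C} = {In j, Out j}" using BC x arcs_at_under_point[OF ji] by simp
    then have "\<gamma> B + \<gamma> C = \<gamma> (In j) + \<gamma> (Out j)"
      using In_neq_Out[of j j] crosses_in[OF ij] by (auto simp: doubleton_eq_iff)
    ultimately show "2 * \<gamma> A = \<gamma> B + \<gamma> C" using rel ij by simp
  qed
qed

text \<open>If the slope of \<open>i\<close> exceeds both neighboring slopes, both under points are below the diagonal and
both over points above it, and conversely if it is smaller than both. In either case the arc between the
under points contains no over point.\<close>

lemma over_arcs_of_extremal_ring:
  assumes "crosses i p" "crosses i q" "p \<noteq> q" "s p < s i \<longleftrightarrow> s q < s i"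
  shows "side i (over_at i p) = Out i"
proof -
  have i: "i \<in> I" using crosses_in assms by auto
  have "{j. crosses i j} = {p, q}" using two_neighbours[OF i] assms(1-3) by (auto simp: doubleton_eq_iff set_eq_iff)
  then have "lo i = min (under_at i p) (under_at i q)" "hi i = max (under_at i p) (under_at i q)"
    by (auto simp: lo_def hi_def)
  then show ?thesis
    using \<tau>(1,2)[OF assms(1)] \<tau>(1,2)[OF assms(2)] assms(4) crosses_slopes[OF assms(1)] crosses_slopes[OF assms(2)]
    by (auto simp: side_def over_at_def under_at_def)
qed

text \<open>Here the cuts are at \<open>4 - \<tau> i p\<close> and \<open>\<tau> i q\<close> and the over points at \<open>\<tau> i p\<close> and \<open>4 - \<tau> i q\<close>. Whichever of \<open>\<tau> i p\<close>
and \<open>\<tau> i q\<close> is smaller, cuts and over points alternate around the ring.\<close>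

lemma over_arcs_of_monotone_ring:
  assumes "crosses i p" "crosses i q" "p \<noteq> q" "s p < s i" "s i < s q"
  shows "{side i (over_at i p), side i (over_at i q)} = {In i, Out i}"
proof -
  have i: "i \<in> I" using crosses_in assms by auto
  have "{j. crosses i j} = {p, q}" using two_neighbours[OF i] assms(1-3) by (auto simp: doubleton_eq_iff set_eq_iff)
  then have "lo i = min (under_at i p) (under_at i q)" "hi i = max (under_at i p) (under_at i q)"
    by (auto simp: lo_def hi_def)
  then show ?thesis
    using \<tau>(1,2)[OF assms(1)] \<tau>(1,2)[OF assms(2)] assms(4,5) \<tau>_neq[OF assms(1-3)]
    by (auto simp: side_def over_at_def under_at_def)
qed

end


section \<open>Color sums along the cycle, and the tent-shaped chain\<close>

context square_cycle
begin

definition ring_sum :: "((real^3) set \<Rightarrow> int) \<Rightarrow> 'a \<Rightarrow> int" where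
  "ring_sum \<gamma> i = \<gamma> (In i) + \<gamma> (Out i)"

lemma over_arc_color:
  "Z_coloring D \<gamma> \<Longrightarrow> crosses i j \<Longrightarrow> 2 * \<gamma> (side i (over_at i j)) = ring_sum \<gamma> j"
  by (auto simp: Z_coloring_D_iff ring_sum_def)

lemma ring_sum_at_extremal_ring:
  assumes "Z_coloring D \<gamma>" "crosses i p" "crosses i q" "p \<noteq> q" "s p < s i \<longleftrightarrow> s q < s i"
  shows "ring_sum \<gamma> p = ring_sum \<gamma> q" "2 * \<gamma> (Out i) = ring_sum \<gamma> p"
  using over_arc_color[OF assms(1,2)] over_arc_color[OF assms(1,3)]
    over_arcs_of_extremal_ring[OF assms(2-5)]
    over_arcs_of_extremal_ring[OF assms(3,2) assms(4)[symmetric] assms(5)[symmetric]] by simp_all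

lemma ring_sum_at_monotone_ring:
  assumes "Z_coloring D \<gamma>" "crosses i p" "crosses i q" "p \<noteq> q" "s p < s i" "s i < s q"
  shows "ring_sum \<gamma> p + ring_sum \<gamma> q = 2 * ring_sum \<gamma> i"
    "2 * \<gamma> (In i) \<in> {ring_sum \<gamma> p, ring_sum \<gamma> q}"
    "2 * \<gamma> (Out i) \<in> {ring_sum \<gamma> p, ring_sum \<gamma> q}"
  using over_arc_color[OF assms(1,2)] over_arc_color[OF assms(1,3)]
    over_arcs_of_monotone_ring[OF assms(2-6)]
  by (auto simp: doubleton_eq_iff ring_sum_def)

lemma ring_cases:
  assumes "i \<in> I"
  obtains (extremal) p q where "crosses i p" "crosses i q" "p \<noteq> q" "{j. crosses i j} = {p, q}"
      "s p < s i \<longleftrightarrow> s q < s i"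
  | (monotone) p q where "crosses i p" "crosses i q" "p \<noteq> q" "{j. crosses i j} = {p, q}"
      "s p < s i" "s i < s q"
proof -
  obtain p q where pq: "p \<noteq> q" "{j. crosses i j} = {p, q}" using two_neighbours[OF assms] by auto
  then have cr: "crosses i p" "crosses i q" by auto
  then have "s p \<noteq> s i" "s q \<noteq> s i" using crosses_slopes[of i] by force+
  then consider "s p < s i \<longleftrightarrow> s q < s i" | "s p < s i" "s i < s q" | "s q < s i" "s i < s p"
    by linarith
  then show ?thesis
    using extremal[OF cr pq] monotone[OF cr pq] monotone[of q p] cr pq by cases auto
qed

text \<open>Arcs that pass over a ring have half the constant as their color. Only at an extremal ring is there an arc
without an over point; its color is then forced by the sum over its own ring.\<close>

lemma trivial_if_ring_sum_const:
  assumes col: "Z_coloring D \<gamma>" and const: "\<And>i. i \<in> I \<Longrightarrow> ring_sum \<gamma> i = K"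
  shows "trivial_coloring D \<gamma>"
proof -
  have "2 * \<gamma> (In i) = K \<and> 2 * \<gamma> (Out i) = K" if i: "i \<in> I" for i
    using i
  proof (cases rule: ring_cases)
    case (extremal p q)
    then have "2 * \<gamma> (Out i) = K"
      using ring_sum_at_extremal_ring(2)[OF col, of i p q] const[of p] crosses_in by auto
    then show ?thesis using const[OF i] by (simp add: ring_sum_def)
  next
    case (monotone p q)
    then show ?thesis
      using ring_sum_at_monotone_ring(2,3)[OF col, of i p q] const[of p] const[of q] crosses_in by auto
  qed
  then have "\<gamma> (In i) = K div 2 \<and> \<gamma> (Out i) = K div 2" if "i \<in> I" for i
    using that by fastforce
  then have "\<forall>A\<in>diagram_arcs D. \<gamma> A = K div 2"
    unfolding diagram_arcs_D by auto
  then show ?thesis by (auto simp: trivial_coloring_def)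
qed

lemma card_ring_sums_le_colors:
  assumes "Z_coloring D \<gamma>"
  shows "card (ring_sum \<gamma> ` I) \<le> card (colors D \<gamma>)"
proof (rule surj_card_le)
  show "finite (colors D \<gamma>)" by (simp add: colors_def diagram_arcs_D finite_I)
  show "ring_sum \<gamma> ` I \<subseteq> (\<lambda>x. 2 * x) ` colors D \<gamma>"
  proof (rule image_subsetI)
    fix j assume "j \<in> I"
    then obtain i where "crosses j i" using two_neighbours[of j] by auto
    then have ij: "crosses i j" by (rule crosses_sym)
    have "\<gamma> (side i (over_at i j)) \<in> colors D \<gamma>"
      using side_in_arcs[OF crosses_in(1)[OF ij]] by (auto simp: colors_def)
    then show "ring_sum \<gamma> j \<in> (\<lambda>x. 2 * x) ` colors D \<gamma>"
      using over_arc_color[OF assms ij] by (metis image_eqI)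
  qed
qed

text \<open>On each ring, color the outer arc, which always contains an over point, by the value of \<open>h\<close> at
the ring below it, and the inner arc by the difference to \<open>2 * h i\<close>. The two hypotheses on \<open>h\<close> say that this agrees
with the colors wanted at the other over points.\<close>

lemma coloring_exists:
  assumes mono: "\<And>i p q. crosses i p \<Longrightarrow> crosses i q \<Longrightarrow> p \<noteq> q \<Longrightarrow> s p < s i \<Longrightarrow> s i < s q \<Longrightarrow> h p + h q = 2 * h i"
    and extr: "\<And>i p q. crosses i p \<Longrightarrow> crosses i q \<Longrightarrow> p \<noteq> q \<Longrightarrow> (s p < s i \<longleftrightarrow> s q < s i) \<Longrightarrow> h p = h q"
  obtains \<gamma> :: "(real^3) set \<Rightarrow> int" where "Z_coloring D \<gamma>" "\<And>i. i \<in> I \<Longrightarrow> ring_sum \<gamma> i = 2 * h i"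
proof -
  have ex: "\<exists>v. \<forall>j. crosses i j \<longrightarrow> (if side i (over_at i j) = Out i then h j = v else h j = 2 * h i - v)"
    if i: "i \<in> I" for i
    using i
  proof (cases rule: ring_cases)
    case (extremal p q)
    then have "j = p \<or> j = q" if "crosses i j" for j using that by blast
    then show ?thesis
      using over_arcs_of_extremal_ring[OF extremal(1,2,3,5)] extr[OF extremal(1,2,3,5)]
        over_arcs_of_extremal_ring[OF extremal(2,1) extremal(3)[symmetric] extremal(5)[symmetric]]
      by (intro exI[of _ "h p"]) auto
  next
    case (monotone p q)
    then have nb: "j = p \<or> j = q" if "crosses i j" for j using that by blast
    have "h p + h q = 2 * h i" using mono monotone by auto
    moreover have "In i \<noteq> Out i" using In_neq_Out i by auto
    moreover have "side i (over_at i p) = In i \<and> side i (over_at i q) = Out i \<or>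
        side i (over_at i p) = Out i \<and> side i (over_at i q) = In i"
      using over_arcs_of_monotone_ring[OF monotone(1,2,3,5,6)] unfolding doubleton_eq_iff by blast
    ultimately show ?thesis
    proof (elim disjE)
      assume sides: "side i (over_at i p) = In i \<and> side i (over_at i q) = Out i"
        and "h p + h q = 2 * h i" "In i \<noteq> Out i"
      then have "if side i (over_at i j) = Out i then h j = h q else h j = 2 * h i - h q"
        if "crosses i j" for j using nb[OF that] by (elim disjE) simp_all
      then show ?thesis by blast
    next
      assume sides: "side i (over_at i p) = Out i \<and> side i (over_at i q) = In i"
        and "h p + h q = 2 * h i" "In i \<noteq> Out i"
      then have "if side i (over_at i j) = Out i then h j = h p else h j = 2 * h i - h p"
        if "crosses i j" for j using nb[OF that] by (elim disjE) simp_all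
      then show ?thesis by blast
    qed
  qed
  \<comment> \<open>v i is the color of the outer arc of ring i\<close>
  then have "\<exists>v. \<forall>i\<in>I. \<forall>j. crosses i j \<longrightarrow>
      (if side i (over_at i j) = Out i then h j = v i else h j = 2 * h i - v i)"
    by (intro bchoice) blast
  then obtain v where "\<forall>i\<in>I. \<forall>j. crosses i j \<longrightarrow>
      (if side i (over_at i j) = Out i then h j = v i else h j = 2 * h i - v i)" ..
  then have v: "if side i (over_at i j) = Out i then h j = v i else h j = 2 * h i - v i"
    if "crosses i j" for i j using that crosses_in(1)[OF that] by blast
  define \<gamma> where "\<gamma> A = (if A \<in> Out ` I then v (inv_into I Out A)
    else 2 * h (inv_into I In A) - v (inv_into I In A))" for A
  have inj: "inj_on In I" "inj_on Out I" using In_eq_iff Out_eq_iff by (auto simp: inj_on_def)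
  have \<gamma>: "\<gamma> (Out i) = v i" "\<gamma> (In i) = 2 * h i - v i" if "i \<in> I" for i
    using that inj In_neq_Out by (auto simp: \<gamma>_def inv_into_f_f)
  have sum: "ring_sum \<gamma> i = 2 * h i" if "i \<in> I" for i
    using \<gamma>[OF that] by (simp add: ring_sum_def)
  have "2 * \<gamma> (side i (over_at i j)) = \<gamma> (In j) + \<gamma> (Out j)" if ij: "crosses i j" for i j
    using v[OF ij] \<gamma>[OF crosses_in(1)[OF ij]] sum[OF crosses_in(2)[OF ij]] In_neq_Out crosses_in[OF ij]
    by (auto simp: ring_sum_def side_def split: if_splits)
  then have "Z_coloring D \<gamma>" by (simp add: Z_coloring_D_iff)
  then show ?thesis using that sum by blast
qed

end

lemma arithmetic_progression:
  fixes f :: "int \<Rightarrow> int"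
  assumes step: "\<And>p. 0 < p \<Longrightarrow> p < k \<Longrightarrow> f (p - 1) + f (p + 1) = 2 * f p" and n: "0 \<le> n" "n \<le> k"
  shows "f n = f 0 + n * (f 1 - f 0)"
proof -
  define d where "d = f 1 - f 0"
  have diff: "f (int m + 1) - f (int m) = d" if "int m + 1 \<le> k" for m
    using that
  proof (induction m)
    case (Suc m)
    then show ?case using step[of "int m + 1"] by (simp add: algebra_simps)
  qed (simp add: d_def)
  have "f (int m) = f 0 + int m * d" if "int m \<le> k" for m
    using that
  proof (induction m)
    case (Suc m)
    then have "f (int m) = f 0 + int m * d" "f (int m + 1) = f (int m) + d"
      using diff[of m] by simp_all
    then show ?case by (simp add: algebra_simps)
  qed simp
  from this[of "nat n"] show ?thesis using n by (simp add: d_def)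
qed

text \<open>For \<open>- k < p < k\<close> the intervals \<open>[2p, 2p + 3]\<close> form a chain in which only consecutive ones overlap. The long
interval \<open>[3 - 2k, 2k]\<close>, with index \<open>k\<close>, contains all of them except that it interleaves with the first and
the last one, and so closes the chain to a cycle. The slopes \<open>\<bar>p\<bar>\<close> rise from \<open>0\<close> to \<open>k\<close> on both ways around
the cycle, so only the rings \<open>0\<close> and \<open>k\<close> are extremal. The bound on \<open>k\<close> makes the two neighbors of each
ring distinct.\<close>

locale tent_chain =
  fixes k :: int
  assumes k_ge_2: "k \<ge> 2"
begin

definition I :: "int set" where "I = {-k<..k}"
definition a :: "int \<Rightarrow> real" where "a p = (if p = k then 3 - 2 * k else 2 * p)"
definition b :: "int \<Rightarrow> real" where "b p = (if p = k then 2 * k else 2 * p + 3)"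
definition s :: "int \<Rightarrow> real" where "s p = of_int \<bar>p\<bar>"

definition adjacent :: "int \<Rightarrow> int \<Rightarrow> bool" where
  "adjacent p q \<longleftrightarrow> q = p + 1 \<or> p = q + 1 \<or> p = k \<and> q = 1 - k \<or> q = k \<and> p = 1 - k"

lemma mem_I: "p \<in> I \<longleftrightarrow> - k < p \<and> p \<le> k"
  by (auto simp: I_def)

lemma s_less_iff: "s p < s q \<longleftrightarrow> \<bar>p\<bar> < \<bar>q\<bar>"
  unfolding s_def of_int_less_iff ..

lemma s_eq_iff: "s p = s q \<longleftrightarrow> \<bar>p\<bar> = \<bar>q\<bar>"
  unfolding s_def of_int_eq_iff ..

text \<open>All end points are integers, so the comparison is settled in integer arithmetic.\<close>

lemma interleaved_iff:
  assumes "p \<in> I" "q \<in> I"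
  shows "interleaved (a p) (b p) (a q) (b q) \<longleftrightarrow> adjacent p q"
proof -
  have "interleaved (a p) (b p) (a q) (b q) \<longleftrightarrow>
     (let a = (\<lambda>p. if p = k then 3 - 2 * k else 2 * p); b = (\<lambda>p. if p = k then 2 * k else 2 * p + 3)
      in a p < a q \<and> a q < b p \<and> b p < b q \<or> a q < a p \<and> a p < b q \<and> b q < b p)"
    by (simp only: interleaved_def a_def b_def Let_def of_int_less_iff)
  also have "\<dots> \<longleftrightarrow> adjacent p q"
    using assms k_ge_2 unfolding I_def adjacent_def Let_def
    by (cases "p = k"; cases "q = k") (simp; presburger)+
  finally show ?thesis .
qed

sublocale square_system I a b s
proof
  show "finite I" "I \<noteq> {}" using k_ge_2 by (auto simp: I_def)
  show "a i < b i" if "i \<in> I" for i using k_ge_2 by (simp add: a_def b_def)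
  show "a i \<noteq> a j \<and> b i \<noteq> b j \<and> a i \<noteq> b j" if "i \<in> I" "j \<in> I" "i \<noteq> j" for i j
  proof -
    have "(if i = k then 3 - 2 * k else 2 * i) \<noteq> (if j = k then 3 - 2 * k else 2 * j)"
      "(if i = k then 2 * k else 2 * i + 3) \<noteq> (if j = k then 2 * k else 2 * j + 3)"
      "(if i = k then 3 - 2 * k else 2 * i) \<noteq> (if j = k then 2 * k else 2 * j + 3)"
      using that by (auto simp: I_def) presburger+
    then show ?thesis unfolding a_def b_def by (simp only: of_int_eq_iff simp_thms)
  qed
  show "s i \<noteq> s j" if "i \<in> I" "j \<in> I" "interleaved (a i) (b i) (a j) (b j)" for i j
    using that interleaved_iff[of i j] k_ge_2
    by (auto simp: s_eq_iff mem_I adjacent_def abs_if split: if_splits) presburger+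
qed

lemma crosses_iff: "crosses p q \<longleftrightarrow> p \<in> I \<and> q \<in> I \<and> adjacent p q"
  using interleaved_iff by (auto simp: crosses_def)

lemma crosses_cases:
  "p \<in> I \<Longrightarrow> {q. crosses p q} =
    {if p = k then 1 - k else p + 1, if p = 1 - k then k else p - 1}"
  using k_ge_2 by (auto simp: crosses_iff adjacent_def mem_I split: if_splits)

sublocale square_cycle I a b s
proof
  fix p assume "p \<in> I"
  moreover have "(if p = k then 1 - k else p + 1) \<noteq> (if p = 1 - k then k else p - 1)"
    using k_ge_2 by auto
  ultimately show "\<exists>q r. q \<noteq> r \<and> {j. crosses p j} = {q, r}" using crosses_cases by blast
qed

lemma connected_chain:
  assumes "J \<subseteq> I" "J \<noteq> {}" and step: "\<And>p q. p \<in> J \<Longrightarrow> crosses p q \<Longrightarrow> q \<in> J"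
  shows "J = I"
proof -
  obtain p where p: "p \<in> J" "p \<in> I" using assms by auto
  have "q \<in> J" if "q \<in> I" for q
  proof (cases "p \<le> q")
    case True
    then have "q \<le> k \<longrightarrow> q \<in> J"
    proof (induction rule: int_ge_induct)
      case (step q)
      then show ?case using assms(3)[of q "q + 1"] p(2) by (auto simp: crosses_iff adjacent_def mem_I)
    qed (use p in auto)
    then show ?thesis using that by (simp add: mem_I)
  next
    case False
    then have "q \<le> p" by simp
    then have "- k < q \<longrightarrow> q \<in> J"
    proof (induction rule: int_le_induct)
      case (step q)
      then show ?case using assms(3)[of q "q - 1"] p(2) by (auto simp: crosses_iff adjacent_def mem_I)
    qed (use p in auto)
    then show ?thesis using that by (simp add: mem_I)
  qed
  then show ?thesis using assms(1) by auto
qed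

text \<open>The sums form arithmetic progressions on both sides of the ring \<open>0\<close>, with the same difference because
that ring is extremal. The left-hand progression stops at \<open>1 - k\<close>; the ring \<open>k\<close> belongs to the
right-hand one.\<close>

lemma ring_sum_eq:
  assumes col: "Z_coloring D \<gamma>" and p: "p \<in> I"
  shows "ring_sum \<gamma> p = ring_sum \<gamma> 0 + \<bar>p\<bar> * (ring_sum \<gamma> 1 - ring_sum \<gamma> 0)"
proof -
  let ?M = "ring_sum \<gamma>"
  have "?M (p - 1) + ?M (p + 1) = 2 * ?M p" if "0 < p" "p < k" for p
    using that by (intro ring_sum_at_monotone_ring(1)[OF col])
      (auto simp: crosses_iff adjacent_def mem_I s_less_iff)
  then have right: "?M p = ?M 0 + p * (?M 1 - ?M 0)" if "0 \<le> p" "p \<le> k" for p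
    using arithmetic_progression[of k ?M p] that by auto
  have "?M (- (p - 1)) + ?M (- (p + 1)) = 2 * ?M (- p)" if "0 < p" "p < k - 1" for p
    using that by (intro ring_sum_at_monotone_ring(1)[OF col])
      (auto simp: crosses_iff adjacent_def mem_I s_less_iff)
  then have left: "?M (- p) = ?M 0 + p * (?M (- 1) - ?M 0)" if "0 \<le> p" "p \<le> k - 1" for p
    using arithmetic_progression[of "k - 1" "\<lambda>p. ?M (- p)" p] that by auto
  have "?M 1 = ?M (- 1)"
    using k_ge_2 by (intro ring_sum_at_extremal_ring(1)[OF col, of 0])
      (auto simp: crosses_iff adjacent_def mem_I s_less_iff)
  then show ?thesis
    using right[of p] left[of "- p"] p by (cases "0 \<le> p") (auto simp: mem_I)
qed

lemma many_colors:
  assumes col: "Z_coloring D \<gamma>" and nontriv: "\<not> trivial_coloring D \<gamma>"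
  shows "nat k + 1 \<le> card (colors D \<gamma>)"
proof -
  let ?M = "ring_sum \<gamma>"
  have "?M 1 \<noteq> ?M 0"
    using trivial_if_ring_sum_const[OF col, of "?M 0"] ring_sum_eq[OF col] nontriv by auto
  moreover have "?M p = ?M 0 + p * (?M 1 - ?M 0)" if "p \<in> {0..k}" for p
    using ring_sum_eq[OF col, of p] that k_ge_2 by (auto simp: mem_I)
  ultimately have "inj_on ?M {0..k}"
    by (intro inj_onI) (metis add_left_cancel eq_iff_diff_eq_0 mult_cancel_right)
  then have "card (?M ` {0..k}) = nat k + 1"
    using k_ge_2 by (simp add: card_image nat_add_distrib)
  moreover have "card (?M ` {0..k}) \<le> card (?M ` I)"
    using k_ge_2 finite_I by (intro card_mono) (auto simp: mem_I)
  ultimately show ?thesis using card_ring_sums_le_colors[OF col] by linarith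
qed

lemma Z_colorable_D: "Z_colorable D"
proof -
  have mono: "\<bar>p\<bar> + \<bar>q\<bar> = 2 * \<bar>i\<bar>"
    if "crosses i p" "crosses i q" "p \<noteq> q" "s p < s i" "s i < s q" for i p q
    using that k_ge_2 by (auto simp: crosses_iff adjacent_def mem_I s_less_iff)
  have extr: "\<bar>p\<bar> = \<bar>q\<bar>"
    if "crosses i p" "crosses i q" "p \<noteq> q" "s p < s i \<longleftrightarrow> s q < s i" for i p q
    using that k_ge_2 by (auto simp: crosses_iff adjacent_def mem_I s_less_iff abs_if split: if_splits)
  obtain \<gamma> :: "(real^3) set \<Rightarrow> int" where col: "Z_coloring D \<gamma>"
    and sum: "\<And>i. i \<in> I \<Longrightarrow> ring_sum \<gamma> i = 2 * \<bar>i\<bar>"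
    by (rule coloring_exists[of abs], (rule mono; assumption), (rule extr; assumption), blast)
  have "\<not> trivial_coloring D \<gamma>"
  proof
    assume "trivial_coloring D \<gamma>"
    then obtain K where "\<And>A. A \<in> diagram_arcs D \<Longrightarrow> \<gamma> A = K" by (auto simp: trivial_coloring_def)
    then have "ring_sum \<gamma> i = 2 * K" if "i \<in> I" for i
      using that by (simp add: ring_sum_def diagram_arcs_D)
    from this[of 0] this[of 1] sum[of 0] sum[of 1] k_ge_2 show False by (simp add: mem_I)
  qed
  then show ?thesis
    using col regular_diagram_D ambient_isotopic_refl by (auto simp: Z_colorable_def diagram_of_def)
qed

end

theorem theorem1p1:
  fixes N :: nat
  assumes "N > 0"
  shows "\<exists>L D. link L \<and> \<not> splittable L \<and> Z_colorable L \<and> minimal_diagram_of D L \<and>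
           (\<forall>\<gamma>. Z_coloring D \<gamma> \<and> \<not> trivial_coloring D \<gamma> \<longrightarrow> N \<le> card (colors D \<gamma>))"
proof -
  interpret tent_chain "int (max N 2)" by unfold_locales simp
  have "link D"
    using polygonal_link_D ambient_isotopic_refl by (auto simp: link_def)
  moreover have "N \<le> card (colors D \<gamma>)" if "Z_coloring D \<gamma>" "\<not> trivial_coloring D \<gamma>" for \<gamma>
    using many_colors[OF that] by simp
  ultimately show ?thesis
    using not_splittable_D[OF connected_chain] Z_colorable_D minimal_diagram_D by blast
qed

end
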